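(* Let $\mu=(\mu_1,\dots,\mu_k)$ be a composition of $n$ and let $\pi\in\mathcal{I}_\mu$ be a $\mu$--involution with blocks $B_1,\dots,B_k$. Then \[ \mathcal{A}_\mu^{-1}(\pi)=\{Q_1Q_2\cdots Q_k : Q_i\in\mathcal{A}^{-1}(B_i)\text{ for } i\in[k]\}, \] where $Q_1Q_2\cdots Q_k$ denotes the concatenation of the words $Q_1,\dots,Q_k$ (a permutation of $[n]$ in one-line notation).
   Context: Permutations are written in one-line notation; for a finite $A\subset\mathbb{N}$, $S_A$ is the set of words using each element of $A$ exactly once, and $S_n=S_{[n]}$. The standardization $\mathrm{std}(Q)\in S_{|A|}$ of $Q\in S_A$ is the permutation with the same relative order as $Q$. $\ell(w)$ is the Coxeter length (number of inversions) of $w\in S_n$, $s_i=(i,i{+}1)$, and $e$ is the identity. The 0--Hecke product is defined by $w\circ s_i=ws_i$ if $\ell(ws_i)>\ell(w)$ and $w\circ s_i=w$ otherwise (similarly $s_i\circ w$), extending to an associative monoid $(S_n,\circ)$. For an involution $y\in S_m$ ($y=y^{-1}$), $\mathrm{Cyc}(y)=\{(j,i): y(i)=j,\ i\le j\}$, $\hat\ell(y)=\tfrac12(\ell(y)+m-|\mathrm{Cyc}(y)|)$, the atoms are $\mathcal{A}(y)=\{w\in S_m: w^{-1}\circ w=y,\ \ell(w)=\hat\ell(y)\}$, and the inverse atoms are $\mathcal{A}^{-1}(y)=\{w^{-1}:w\in\mathcal{A}(y)\}$. A word $Q\in S_A$ is a block involution if $\mathrm{std}(Q)$ is an involution; its inverse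 block atoms are $\mathcal{A}^{-1}(Q)=\{Q'\in S_A: \mathrm{std}(Q')\in\mathcal{A}^{-1}(\mathrm{std}(Q))\}$. For a composition $\mu=(\mu_1,\dots,\mu_k)$ of $n$ and $\pi\in S_n$, set $m_r=\mu_1+\dots+\mu_{r-1}$; the $r$th block of $\pi$ is the word $B_r=\pi(m_r{+}1)\cdots\pi(m_r{+}\mu_r)$. $\pi$ is a $\mu$--involution if every block is a block involution; $\mathcal{I}_\mu$ is the set of these. For $\pi\in\mathcal{I}_\mu$ and $i\in[n-1]$ define $\pi\circ_\mu s_i$: if the values $i,i{+}1$ lie in different blocks, $\pi\circ_\mu s_i=s_i\circ\pi$ (swap the values $i,i{+}1$ if $i$ occurs to the left of $i{+}1$, otherwise leave $\pi$ unchanged); if they lie in the same block $B$, replace $B$ by the word on the same values whose standardization is $s_r\circ\mathrm{std}(B)\circ s_r$, where $i$ is the $r$th smallest value of $B$, leaving other blocks unchanged. This extends to a right action of the 0--Hecke monoid, so $e\circ_\mu w$ is well defined for $w\in S_n$. A $\mu$--word for $\pi$ is $(a_1,\dots,a_p)$ with $\pi=e\circ_\mu s_{a_1}\circ_\mu\cdots\circ_\mu s_{a_p}$; $\ell_\mu(\pi)$ is the minimal length of one. The $\mu$--atoms are $\mathcal{A}_\mu(\pi)=\{w\in S_n: e\circ_\mu w=\pi,\ \ell(w)=\ell_\mu(\pi)\}$ and $\mathcal{A}_\mu^{-1}(\pi)=\{w^{-1}:w\in\mathcal{A}_\mu(\pi)\}$. *)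

theory Defs
  imports Complex_Main "HOL-Combinatorics.Combinatorics"
begin

text \<open>
  An element of the symmetric group on \<open>{1..n}\<close> is a function \<open>w :: nat \<Rightarrow> nat\<close> with
  \<open>w permutes {1..n}\<close>; words are lists. The words using each element of a finite set \<open>A\<close>
  exactly once are \<^term>\<open>permutations_of_set A\<close>. Positions in words and indices of
  generators are 1-based, as usual for permutations, whereas the blocks of a composition are
  indexed from 0, as entries of a list.
\<close>

definition one_line :: "nat \<Rightarrow> (nat \<Rightarrow> nat) \<Rightarrow> nat list" where
  "one_line n w = map w [1..<Suc n]"

definition perm_of_word :: "nat list \<Rightarrow> nat \<Rightarrow> nat" where
  "perm_of_word Q = (\<lambda>i. if i \<in> {1..length Q} then Q ! (i - 1) else i)"

definition rank :: "nat set \<Rightarrow> nat \<Rightarrow> nat" where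
  "rank A x = card {y \<in> A. y \<le> x}"

definition std :: "nat list \<Rightarrow> nat \<Rightarrow> nat" where
  "std Q = perm_of_word (map (rank (set Q)) Q)"


subsection \<open>The 0-Hecke monoid\<close>

text \<open>For \<open>w\<close> permuting \<open>{1..n}\<close> every inversion lies in \<open>{1..n}\<close>, so the set is finite.\<close>

definition coxeter_length :: "(nat \<Rightarrow> nat) \<Rightarrow> nat" where
  "coxeter_length w = card {(i, j). i < j \<and> w j < w i}"

abbreviation simple_refl :: "nat \<Rightarrow> nat \<Rightarrow> nat" where
  "simple_refl i \<equiv> transpose i (i + 1)"

definition hecke_right :: "(nat \<Rightarrow> nat) \<Rightarrow> nat \<Rightarrow> nat \<Rightarrow> nat" where
  "hecke_right w i =
    (if coxeter_length (w \<circ> simple_refl i) > coxeter_length w then w \<circ> simple_refl i else w)"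

definition hecke_left :: "nat \<Rightarrow> (nat \<Rightarrow> nat) \<Rightarrow> nat \<Rightarrow> nat" where
  "hecke_left i w =
    (if coxeter_length (simple_refl i \<circ> w) > coxeter_length w then simple_refl i \<circ> w else w)"

text \<open>
  A right action of the generators is extended to \<open>w\<close> by letting the letters of a word act
  successively, for any word in the generators whose 0-Hecke product is \<open>w\<close>; the result does
  not depend on the word when the generators act through the 0-Hecke monoid. Taking for the
  action the right multiplication by generators gives the 0-Hecke product itself.
\<close>

definition extend_action ::
    "nat \<Rightarrow> ('a \<Rightarrow> nat \<Rightarrow> 'a) \<Rightarrow> 'a \<Rightarrow> (nat \<Rightarrow> nat) \<Rightarrow> 'a" where
  "extend_action n act x w =
    (THE x'. \<exists>a. set a \<subseteq> {1..<n} \<and> foldl hecke_right id a = w \<and> foldl act x a = x')"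

definition hecke_prod :: "nat \<Rightarrow> (nat \<Rightarrow> nat) \<Rightarrow> (nat \<Rightarrow> nat) \<Rightarrow> nat \<Rightarrow> nat" where
  "hecke_prod n = extend_action n hecke_right"


subsection \<open>Involutions and their atoms\<close>

definition involution :: "nat \<Rightarrow> (nat \<Rightarrow> nat) \<Rightarrow> bool" where
  "involution m y \<longleftrightarrow> y permutes {1..m} \<and> y = inv y"

definition Cyc :: "nat \<Rightarrow> (nat \<Rightarrow> nat) \<Rightarrow> (nat \<times> nat) set" where
  "Cyc m y = {(j, i). i \<in> {1..m} \<and> y i = j \<and> i \<le> j}"

definition inv_length :: "nat \<Rightarrow> (nat \<Rightarrow> nat) \<Rightarrow> rat" where
  "inv_length m y = (of_nat (coxeter_length y) + of_nat m - of_nat (card (Cyc m y))) / 2"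

definition atoms :: "nat \<Rightarrow> (nat \<Rightarrow> nat) \<Rightarrow> (nat \<Rightarrow> nat) set" where
  "atoms m y = {w. w permutes {1..m} \<and> hecke_prod m (inv w) w = y \<and>
                   of_nat (coxeter_length w) = inv_length m y}"

definition inverse_atoms :: "nat \<Rightarrow> (nat \<Rightarrow> nat) \<Rightarrow> (nat \<Rightarrow> nat) set" where
  "inverse_atoms m y = inv ` atoms m y"

definition block_involution :: "nat list \<Rightarrow> bool" where
  "block_involution Q \<longleftrightarrow> distinct Q \<and> involution (length Q) (std Q)"

definition inverse_block_atoms :: "nat list \<Rightarrow> nat list set" where
  "inverse_block_atoms Q =
    {Q' \<in> permutations_of_set (set Q). std Q' \<in> inverse_atoms (length Q) (std Q)}"


subsection \<open>Involutions relative to a composition\<close>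

definition composition :: "nat list \<Rightarrow> nat \<Rightarrow> bool" where
  "composition \<mu> n \<longleftrightarrow> (\<forall>x \<in> set \<mu>. 0 < x) \<and> sum_list \<mu> = n"

definition block :: "nat list \<Rightarrow> (nat \<Rightarrow> nat) \<Rightarrow> nat \<Rightarrow> nat list" where
  "block \<mu> \<pi> r = (let m = sum_list (take r \<mu>) in map \<pi> [m + 1..<m + \<mu> ! r + 1])"

definition blocks :: "nat list \<Rightarrow> (nat \<Rightarrow> nat) \<Rightarrow> nat list list" where
  "blocks \<mu> \<pi> = map (block \<mu> \<pi>) [0..<length \<mu>]"

definition mu_involutions :: "nat list \<Rightarrow> (nat \<Rightarrow> nat) set" where
  "mu_involutions \<mu> =
    {\<pi>. \<pi> permutes {1..sum_list \<mu>} \<and> (\<forall>B \<in> set (blocks \<mu> \<pi>). block_involution B)}"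

definition conj_block :: "nat \<Rightarrow> nat list \<Rightarrow> nat list" where
  "conj_block i B =
    (let r = rank (set B) i in
      THE Q. Q \<in> permutations_of_set (set B) \<and>
             std Q = hecke_right (hecke_left r (std B)) r)"

definition mu_act_gen :: "nat list \<Rightarrow> (nat \<Rightarrow> nat) \<Rightarrow> nat \<Rightarrow> nat \<Rightarrow> nat" where
  "mu_act_gen \<mu> \<pi> i =
    (if \<exists>B \<in> set (blocks \<mu> \<pi>). {i, i + 1} \<subseteq> set B
     then perm_of_word
            (concat (map (\<lambda>B. if {i, i + 1} \<subseteq> set B then conj_block i B else B) (blocks \<mu> \<pi>)))
     else hecke_left i \<pi>)"

definition mu_act :: "nat list \<Rightarrow> (nat \<Rightarrow> nat) \<Rightarrow> (nat \<Rightarrow> nat) \<Rightarrow> nat \<Rightarrow> nat" where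
  "mu_act \<mu> = extend_action (sum_list \<mu>) (mu_act_gen \<mu>)"

definition mu_word :: "nat list \<Rightarrow> (nat \<Rightarrow> nat) \<Rightarrow> nat list \<Rightarrow> bool" where
  "mu_word \<mu> \<pi> a \<longleftrightarrow> set a \<subseteq> {1..<sum_list \<mu>} \<and> \<pi> = foldl (mu_act_gen \<mu>) id a"

definition mu_length :: "nat list \<Rightarrow> (nat \<Rightarrow> nat) \<Rightarrow> nat" where
  "mu_length \<mu> \<pi> = (LEAST p. \<exists>a. mu_word \<mu> \<pi> a \<and> length a = p)"

definition mu_atoms :: "nat list \<Rightarrow> (nat \<Rightarrow> nat) \<Rightarrow> (nat \<Rightarrow> nat) set" where
  "mu_atoms \<mu> \<pi> = {w. w permutes {1..sum_list \<mu>} \<and> mu_act \<mu> id w = \<pi> \<and>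
                      coxeter_length w = mu_length \<mu> \<pi>}"

definition inverse_mu_atoms :: "nat list \<Rightarrow> (nat \<Rightarrow> nat) \<Rightarrow> (nat \<Rightarrow> nat) set" where
  "inverse_mu_atoms \<mu> \<pi> = inv ` mu_atoms \<mu> \<pi>"

end

theory Submission
  imports Defs
begin

text \<open>
  Put \<open>v = w\<inverse>\<close> and cut \<open>v\<close> into blocks \<open>Q\<^sub>r\<close> according to \<open>\<mu>\<close>. By induction on a word for \<open>w\<close>,
  the \<open>r\<close>th block \<open>B\<^sub>r\<close> of \<open>e \<circ>\<^sub>\<mu> w\<close> has the same letters as \<open>Q\<^sub>r\<close>, and its standardization is
  the 0-Hecke product of \<open>u\<^sub>r = std Q\<^sub>r\<close> and \<open>u\<^sub>r\<inverse>\<close>: a generator \<open>s\<^sub>i\<close> whose values lie in different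
  blocks acts in the same way on \<open>v\<close> and on the \<open>\<mu>\<close>-involution, and otherwise it multiplies one
  \<open>u\<^sub>r\<close> on the left. The length of \<open>v\<close> is the sum of the lengths of the \<open>u\<^sub>r\<close> and the number of
  inversions between different blocks, which depends only on the sets of letters of the blocks.
  So the length is minimal if and only if each \<open>u\<^sub>r\<close> is as short as possible, and the least length
  of an element with 0-Hecke square \<open>y\<close> is \<open>inv_length m y\<close>, because conjugating an involution by
  a simple reflection at an ascent increases this quantity by exactly 1.
\<close>

section \<open>Length and the 0-Hecke operators\<close>

lemma hecke_right_Suc:
  "hecke_right w i = (if coxeter_length w < coxeter_length (w \<circ> transpose i (Suc i))
    then w \<circ> transpose i (Suc i) else w)"
  by (simp add: hecke_right_def)

lemma hecke_left_Suc:
  "hecke_left i w = (if coxeter_length w < coxeter_length (transpose i (Suc i) \<circ> w)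
    then transpose i (Suc i) \<circ> w else w)"
  by (simp add: hecke_left_def)

text \<open>Otherwise \<open>{1..n}\<close> could be rewritten to \<open>{Suc 0..n}\<close>, and
  facts about permutations of \<open>{1..n}\<close> would stop matching.\<close>

declare One_nat_def [simp del]

text \<open>No number lies strictly between \<open>i\<close> and \<open>Suc i\<close>, so the
  adjacent swap reverses the order of this one pair and of no other.\<close>

lemma transpose_Suc_less_iff:
  assumes "{x, y} \<noteq> {i, Suc i}"
  shows "transpose i (Suc i) x < transpose i (Suc i) y \<longleftrightarrow> x < y"
  using assms by (auto simp: transpose_def)

text \<open>\<open>w\<close> fixes 0, so 0 cannot be the left end of an inversion. It fixes each
  \<open>j > n\<close>, whose value exceeds all values to its left, so such a \<open>j\<close>
  cannot be the right end.\<close>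

lemma inversion_bounds:
  fixes w :: "nat \<Rightarrow> nat"
  assumes w: "w permutes {1..n}" and ij: "i < j" "w j < w i"
  shows "0 < i" "j \<le> n"
proof -
  show "0 < i"
  proof (rule ccontr)
    assume "\<not> 0 < i"
    then have "i = 0" by simp
    then have "w i = 0" using permutes_not_in[OF w, of 0] by simp
    with ij show False by simp
  qed
  show "j \<le> n"
  proof (rule ccontr)
    assume "\<not> j \<le> n"
    then have "w j = j" using permutes_not_in[OF w, of j] by simp
    moreover have "w i \<le> max i n"
      using permutes_in_image[OF w, of i] permutes_not_in[OF w, of i]
      by (cases "i \<in> {1..n}") auto
    ultimately show False using ij \<open>\<not> j \<le> n\<close> by auto
  qed
qed

lemma finite_inversions:
  fixes w :: "nat \<Rightarrow> nat"
  assumes "w permutes {1..n}"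
  shows "finite {(i, j). i < j \<and> w j < w i}"
proof (rule finite_subset)
  show "{(i, j). i < j \<and> w j < w i} \<subseteq> {..n} \<times> {..n}"
  proof (rule subrelI)
    fix i j assume "(i, j) \<in> {(i, j). i < j \<and> w j < w i}"
    then have ij: "i < j" "w j < w i" by auto
    with inversion_bounds(2)[OF assms ij] show "(i, j) \<in> {..n} \<times> {..n}" by simp
  qed
qed simp

text \<open>Moving both positions by the transposition maps the inversions of \<open>w\<close>
  injectively to inversions of the product; \<open>(i, Suc i)\<close> is the only one not
  reached.\<close>

lemma coxeter_length_ascent:
  assumes w: "w permutes {1..n}" and asc: "w i < w (Suc i)"
  shows "coxeter_length (w \<circ> transpose i (Suc i)) = Suc (coxeter_length w)"
proof -
  let ?s = "transpose i (Suc i)"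
  let ?I = "{(i, j). i < j \<and> w j < w i}"
  have "{(a, b). a < b \<and> (w \<circ> ?s) b < (w \<circ> ?s) a} = insert (i, Suc i) (map_prod ?s ?s ` ?I)"
    (is "?L = ?R")
  proof
    show "?L \<subseteq> ?R"
    proof clarify
      fix a b assume ab: "a < b" "(w \<circ> ?s) b < (w \<circ> ?s) a"
        "(a, b) \<notin> map_prod ?s ?s ` ?I"
      show "a = i \<and> b = Suc i"
      proof (rule ccontr)
        assume "\<not> (a = i \<and> b = Suc i)"
        then have "{a, b} \<noteq> {i, Suc i}" using ab(1) by (auto simp: doubleton_eq_iff)
        then have "?s a < ?s b" using ab(1) by (simp add: transpose_Suc_less_iff)
        then have "(?s a, ?s b) \<in> ?I" using ab(2) by simp
        then have "map_prod ?s ?s (?s a, ?s b) \<in> map_prod ?s ?s ` ?I" by blast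
        then show False using ab(3) by simp
      qed
    qed
    show "?R \<subseteq> ?L"
    proof -
      have "?s a < ?s b" if "a < b" "w b < w a" for a b
      proof -
        have "{a, b} \<noteq> {i, Suc i}" using that asc by (auto simp: doubleton_eq_iff)
        then show ?thesis using that by (simp add: transpose_Suc_less_iff)
      qed
      then show ?thesis using asc by auto
    qed
  qed
  moreover have "(i, Suc i) \<notin> map_prod ?s ?s ` ?I"
  proof
    assume "(i, Suc i) \<in> map_prod ?s ?s ` ?I"
    then obtain a b where "a < b" "i = ?s a" "Suc i = ?s b" by auto
    then show False by (auto simp: transpose_def split: if_splits)
  qed
  moreover have "inj (map_prod ?s ?s)"
    by (intro prod.inj_map inj_transpose)
  ultimately show ?thesis
    unfolding coxeter_length_def using finite_inversions[OF w]
    by (simp add: card_image inj_on_subset)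
qed

lemma coxeter_length_id: "coxeter_length id = 0"
proof -
  have "{(i::nat, j). i < j \<and> id j < id i} = {}" by auto
  then show ?thesis unfolding coxeter_length_def by (metis card.empty)
qed

lemma permutes_comp_transpose:
  assumes "w permutes {1..n}" "i \<in> {1..<n}"
  shows "w \<circ> transpose i (Suc i) permutes {1..n}" "transpose i (Suc i) \<circ> w permutes {1..n}"
  using assms by (auto intro!: permutes_compose permutes_swap_id)

lemma coxeter_length_descent:
  assumes w: "w permutes {1..n}" and i: "i \<in> {1..<n}" and desc: "w (Suc i) < w i"
  shows "Suc (coxeter_length (w \<circ> transpose i (Suc i))) = coxeter_length w"
  using coxeter_length_ascent[OF permutes_comp_transpose(1)[OF w i], of i] desc
  by (simp add: comp_assoc)

text \<open>Reading an inversion by its values in place of its positions gives an inversion of the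
  inverse.\<close>

lemma coxeter_length_inv:
  assumes "w permutes {1..n}"
  shows "coxeter_length (inv w) = coxeter_length w"
proof -
  have "bij_betw (\<lambda>(i, j). (w j, w i)) {(i, j). i < j \<and> w j < w i} {(i, j). i < j \<and> inv w j < inv w i}"
    by (rule bij_betw_byWitness[where f' = "\<lambda>(i, j). (inv w j, inv w i)"])
       (simp_all add: permutes_inverses[OF assms] image_subset_iff split_beta)
  from bij_betw_same_card[OF this] show ?thesis
    unfolding coxeter_length_def by (rule sym)
qed

text \<open>Turns the length comparison of the definition into a comparison of two adjacent
  values.\<close>

lemma hecke_right_eq:
  assumes w: "w permutes {1..n}" and i: "i \<in> {1..<n}"
  shows "hecke_right w i = (if w i < w (Suc i) then w \<circ> transpose i (Suc i) else w)"
proof (cases "w i < w (Suc i)")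
  case True
  then show ?thesis using coxeter_length_ascent[OF w True] by (simp add: hecke_right_Suc)
next
  case False
  moreover have "w i \<noteq> w (Suc i)" using permutes_inj[OF w] by (simp add: inj_eq)
  ultimately have "w (Suc i) < w i" by simp
  then have "\<not> coxeter_length w < coxeter_length (w \<circ> transpose i (Suc i))"
    using coxeter_length_descent[OF w i] by linarith
  with False show ?thesis unfolding hecke_right_Suc by (simp only: if_False)
qed

lemma inv_comp_transpose:
  assumes "w permutes S"
  shows "inv (w \<circ> transpose i j) = transpose i j \<circ> inv w"
    "inv (transpose i j \<circ> w) = inv w \<circ> transpose i j"
  using o_inv_distrib[OF permutes_bij[OF assms] bij_transpose[of i j]]
    o_inv_distrib[OF bij_transpose[of i j] permutes_bij[OF assms]]
  by (simp_all only: inv_transpose_eq)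

text \<open>Inversion keeps the length and exchanges left and right multiplication, so facts on
  \<open>hecke_right\<close> carry over to \<open>hecke_left\<close>.\<close>

lemma inv_hecke_left:
  assumes w: "w permutes {1..n}" and i: "i \<in> {1..<n}"
  shows "inv (hecke_left i w) = hecke_right (inv w) i"
  unfolding hecke_left_Suc hecke_right_Suc
  using coxeter_length_inv[OF w] coxeter_length_inv[OF permutes_comp_transpose(2)[OF w i]]
  by (simp add: inv_comp_transpose[OF w])

lemma hecke_left_eq:
  assumes w: "w permutes {1..n}" and i: "i \<in> {1..<n}"
  shows "hecke_left i w = (if inv w i < inv w (Suc i) then transpose i (Suc i) \<circ> w else w)"
proof -
  have "hecke_left i w = inv (inv (hecke_left i w))"
    using permutes_comp_transpose(2)[OF w i] w
    by (auto simp: hecke_left_Suc permutes_inv_inv)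
  also have "\<dots> = (if inv w i < inv w (Suc i) then transpose i (Suc i) \<circ> w else w)"
    using w by (simp add: inv_hecke_left[OF w i] hecke_right_eq[OF permutes_inv[OF w] i]
        inv_comp_transpose[OF permutes_inv[OF w]] permutes_inv_inv)
  finally show ?thesis .
qed

lemma hecke_permutes:
  assumes "w permutes {1..n}" "i \<in> {1..<n}"
  shows "hecke_right w i permutes {1..n}" "hecke_left i w permutes {1..n}"
  using assms permutes_comp_transpose[OF assms] by (auto simp: hecke_right_Suc hecke_left_Suc)

lemma inv_hecke_right:
  assumes w: "w permutes {1..n}" and i: "i \<in> {1..<n}"
  shows "inv (hecke_right w i) = hecke_left i (inv w)"
  using inv_hecke_left[OF permutes_inv[OF w] i] hecke_permutes(2)[OF permutes_inv[OF w] i] w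
  by (metis permutes_inv_inv)

text \<open>The left operator looks at the positions of the values \<open>i\<close> and
  \<open>Suc i\<close>, the right one at the values in positions \<open>j\<close> and
  \<open>Suc j\<close>. Neither affects the test of the other unless both look at the same pair.
  This commutation is what makes the 0-Hecke product well defined.\<close>

lemma hecke_left_right_commute:
  assumes w: "w permutes {1..n}" and i: "i \<in> {1..<n}" and j: "j \<in> {1..<n}"
  shows "hecke_left i (hecke_right w j) = hecke_right (hecke_left i w) j"
proof -
  let ?s = "transpose i (Suc i)" and ?t = "transpose j (Suc j)"
  note [simp] = inv_comp_transpose[OF w] permutes_inverses[OF w]
    hecke_left_eq[OF w i] hecke_right_eq[OF w j]
    hecke_left_eq[OF permutes_comp_transpose(1)[OF w j] i]
    hecke_right_eq[OF permutes_comp_transpose(2)[OF w i] j]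
    hecke_right_eq[OF permutes_comp_transpose(1)[OF w j] j]
  show ?thesis
  proof (cases "{w j, w (Suc j)} = {i, Suc i}")
    case True
    then consider "w j = i" "w (Suc j) = Suc i" | "w j = Suc i" "w (Suc j) = i"
      by (auto simp: doubleton_eq_iff)
    then show ?thesis
    proof cases
      case 1
      then have inv: "inv w i = j" "inv w (Suc i) = Suc j"
        using permutes_inv_eq[OF w] by auto
      \<comment> \<open>Both operators would perform the same swap, so whichever comes first uses it
        up and the second does nothing.\<close>
      have "?s \<circ> w = w \<circ> ?t"
        using 1 permutes_inj[OF w]
        by (simp add: fun_eq_iff transpose_def) (metis injD)
      then show ?thesis using 1 inv by simp
    next
      case 2
      then have inv: "inv w i = Suc j" "inv w (Suc i) = j"
        using permutes_inv_eq[OF w] by auto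
      then show ?thesis using 2 by simp
    qed
  next
    case False
    have "{inv w i, inv w (Suc i)} \<noteq> {j, Suc j}"
    proof
      assume "{inv w i, inv w (Suc i)} = {j, Suc j}"
      then have "w ` {inv w i, inv w (Suc i)} = w ` {j, Suc j}" by simp
      with False show False by simp
    qed
    with False show ?thesis
      by (simp add: transpose_Suc_less_iff comp_assoc)
  qed
qed

section \<open>Words acting from the left and from the right\<close>

lemma foldl_hecke_permutes:
  assumes "w permutes {1..n}" "set a \<subseteq> {1..<n}"
  shows "foldl hecke_right w a permutes {1..n}" "foldl (\<lambda>x i. hecke_left i x) w a permutes {1..n}"
proof -
  show "foldl hecke_right w a permutes {1..n}"
    using assms
  proof (induction a arbitrary: w)
    case (Cons i a)
    then show ?case using Cons.IH[OF hecke_permutes(1)[of w n i]] by simp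
  qed simp
  show "foldl (\<lambda>x i. hecke_left i x) w a permutes {1..n}"
    using assms
  proof (induction a arbitrary: w)
    case (Cons i a)
    then show ?case using Cons.IH[OF hecke_permutes(2)[of w n i]] by simp
  qed simp
qed

lemma inv_foldl_hecke_right:
  assumes "w permutes {1..n}" "set a \<subseteq> {1..<n}"
  shows "inv (foldl hecke_right w a) = foldl (\<lambda>x i. hecke_left i x) (inv w) a"
  using assms
proof (induction a arbitrary: w)
  case (Cons i a)
  then show ?case
    using Cons.IH[OF hecke_permutes(1)[of w n i]] inv_hecke_right[of w n i] by simp
qed simp

lemma foldl_hecke_commute:
  assumes "w permutes {1..n}" "set a \<subseteq> {1..<n}" "set b \<subseteq> {1..<n}"
  shows "foldl hecke_right (foldl (\<lambda>x i. hecke_left i x) w b) a =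
    foldl (\<lambda>x i. hecke_left i x) (foldl hecke_right w a) b"
proof -
  have step: "foldl (\<lambda>x i. hecke_left i x) (hecke_right w j) b =
      hecke_right (foldl (\<lambda>x i. hecke_left i x) w b) j"
    if "w permutes {1..n}" "j \<in> {1..<n}" for w j
    using that assms(3)
  proof (induction b arbitrary: w)
    case (Cons i b)
    then show ?case
      using Cons.IH[OF hecke_permutes(2)[of w n i]] hecke_left_right_commute[of w n i j] by simp
  qed simp
  show ?thesis
    using assms(1,2)
  proof (induction a arbitrary: w)
    case (Cons j a)
    then have j: "j \<in> {1..<n}" and a: "set a \<subseteq> {1..<n}" by auto
    show ?case
      using Cons.IH[OF hecke_permutes(1)[OF Cons.prems(1) j] a] step[OF Cons.prems(1) j] by simp
  qed simp
qed

section \<open>Descents and reduced words\<close>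

text \<open>Without descents \<open>i \<le> w i\<close> on \<open>{1..n}\<close>. Both sides have
  the same sum over this interval, so all the inequalities are equalities.\<close>

lemma no_descent_imp_id:
  assumes w: "w permutes {1..n}" and "\<And>i. i \<in> {1..<n} \<Longrightarrow> w i < w (Suc i)"
  shows "w = id"
proof -
  have ge: "i \<le> w i" if "i \<le> n" for i
    using that
  proof (induction i)
    case (Suc i)
    show ?case
    proof (cases "i = 0")
      case True
      then show ?thesis using permutes_in_image[OF w, of 1] Suc.prems by (auto simp: One_nat_def)
    next
      case False
      then show ?thesis using assms(2)[of i] Suc by auto
    qed
  qed simp
  have "sum w {1..n} = sum id {1..n}"
    using sum.permute[OF w, of id] by (simp add: comp_def)
  then have "\<And>i. i \<in> {1..n} \<Longrightarrow> w i = i"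
    using sum_mono_inv[of id "{1..n}" w] ge by auto
  then show ?thesis
    using permutes_not_in[OF w] by (intro ext) (metis id_apply)
qed

lemma ex_descent:
  assumes w: "w permutes {1..n}" and "w \<noteq> id"
  obtains i where "i \<in> {1..<n}" "w (Suc i) < w i"
proof -
  obtain i where "i \<in> {1..<n}" "\<not> w i < w (Suc i)"
    using no_descent_imp_id[OF w] assms(2) by blast
  moreover have "w i \<noteq> w (Suc i)" using permutes_inj[OF w] by (simp add: inj_eq)
  ultimately show ?thesis using that by simp
qed

text \<open>An ordinary right multiplication removes a descent. Appended to a word for the shorter
  permutation, the same letter meets an ascent, so the 0-Hecke operator performs the swap.\<close>

lemma ex_reduced_word:
  assumes "w permutes {1..n}"
  shows "\<exists>a. set a \<subseteq> {1..<n} \<and> foldl hecke_right id a = w \<and> length a = coxeter_length w"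
  using assms
  proof (induction "coxeter_length w" arbitrary: w rule: less_induct)
    case less
    show ?case
    proof (cases "w = id")
      case True
      then show ?thesis by (intro exI[of _ "[]"]) (auto simp: coxeter_length_id)
    next
      case False
      then obtain i where i: "i \<in> {1..<n}" "w (Suc i) < w i"
        using ex_descent[OF less.prems] by blast
      let ?v = "w \<circ> transpose i (Suc i)"
      have v: "?v permutes {1..n}" using permutes_comp_transpose less.prems i by blast
      have len: "Suc (coxeter_length ?v) = coxeter_length w"
        using coxeter_length_descent less.prems i by blast
      then obtain a where a: "set a \<subseteq> {1..<n}" "foldl hecke_right id a = ?v"
        "length a = coxeter_length ?v"
        using less.hyps[OF _ v] by auto
      have "hecke_right ?v i = w"
        using i hecke_right_eq[OF v i(1)] by (simp add: comp_assoc)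
      then show ?thesis using a i len by (intro exI[of _ "a @ [i]"]) auto
    qed
  qed

lemma coxeter_length_foldl_le:
  assumes "set a \<subseteq> {1..<n}"
  shows "coxeter_length (foldl hecke_right id a) \<le> length a"
  using assms
proof (induction a rule: rev_induct)
  case (snoc i a)
  have "coxeter_length (hecke_right w i) \<le> Suc (coxeter_length w)" if "w permutes {1..n}" for w
    using that snoc.prems coxeter_length_ascent[OF that, of i] by (auto simp: hecke_right_eq)
  moreover have "foldl hecke_right id a permutes {1..n}"
    using foldl_hecke_permutes(1)[OF permutes_id] snoc.prems by simp
  ultimately have "coxeter_length (foldl hecke_right id (a @ [i])) \<le>
      Suc (coxeter_length (foldl hecke_right id a))" by simp
  also have "\<dots> \<le> Suc (length a)"
    using snoc.IH snoc.prems by (metis Suc_le_mono le_sup_iff set_append)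
  also have "\<dots> = length (a @ [i])" by simp
  finally show ?case .
qed (simp add: coxeter_length_id)

section \<open>Extended actions and the 0-Hecke product\<close>

text \<open>The first assumption is independence of the chosen word; it supplies the uniqueness that
  the definite description in \<open>extend_action\<close> asks for.\<close>

lemma extend_action_eq:
  assumes "\<And>b. set b \<subseteq> {1..<n} \<Longrightarrow> foldl hecke_right id b = foldl hecke_right id a \<Longrightarrow>
      foldl act x b = foldl act x a"
    and "set a \<subseteq> {1..<n}"
  shows "extend_action n act x (foldl hecke_right id a) = foldl act x a"
  unfolding extend_action_def
proof (rule the_equality)
  show "\<exists>b. set b \<subseteq> {1..<n} \<and> foldl hecke_right id b = foldl hecke_right id a \<and>
      foldl act x b = foldl act x a"
    using assms(2) by blast
next
  fix y
  assume "\<exists>b. set b \<subseteq> {1..<n} \<and> foldl hecke_right id b = foldl hecke_right id a \<and> foldl act x b = y"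
  then obtain b where b: "set b \<subseteq> {1..<n}" "foldl hecke_right id b = foldl hecke_right id a"
    "foldl act x b = y" by blast
  show "y = foldl act x a" using assms(1)[OF b(1,2)] unfolding b(3) .
qed

text \<open>Well defined because left and right multiplications commute: \<open>u\<close> is obtained from the
  identity by left multiplications, which can be performed after the right multiplications.\<close>

lemma hecke_prod_eq_foldl:
  assumes u: "u permutes {1..n}" and a: "set a \<subseteq> {1..<n}"
  shows "hecke_prod n u (foldl hecke_right id a) = foldl hecke_right u a"
  unfolding hecke_prod_def
proof (rule extend_action_eq[OF _ a])
  obtain c where c: "set c \<subseteq> {1..<n}" "foldl hecke_right id c = inv u"
    using ex_reduced_word[OF permutes_inv[OF u]] by blast
  have "u = inv (foldl hecke_right id c)"
    unfolding c(2) by (rule permutes_inv_inv[OF u, symmetric])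
  also have "\<dots> = foldl (\<lambda>x i. hecke_left i x) id c"
    using inv_foldl_hecke_right[OF permutes_id c(1)] unfolding inv_id .
  finally have u_eq: "u = foldl (\<lambda>x i. hecke_left i x) id c" .
  have eq: "foldl hecke_right u b = foldl (\<lambda>x i. hecke_left i x) (foldl hecke_right id b) c"
    if "set b \<subseteq> {1..<n}" for b
    unfolding u_eq by (rule foldl_hecke_commute[OF permutes_id that c(1)])
  show "foldl hecke_right u b = foldl hecke_right u a"
    if "set b \<subseteq> {1..<n}" "foldl hecke_right id b = foldl hecke_right id a" for b
    unfolding eq[OF that(1)] eq[OF a] that(2) by (rule refl)
qed

lemma hecke_prod_id: "hecke_prod n id id = id"
  using hecke_prod_eq_foldl[OF permutes_id, of "[]"] by simp

lemma hecke_prod_right: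
  assumes "u permutes {1..n}" "v permutes {1..n}" "i \<in> {1..<n}"
  shows "hecke_prod n u (hecke_right v i) = hecke_right (hecke_prod n u v) i"
proof -
  obtain a where "set a \<subseteq> {1..<n}" "foldl hecke_right id a = v"
    using ex_reduced_word[OF assms(2)] by blast
  then show ?thesis
    using hecke_prod_eq_foldl[OF assms(1), of a] hecke_prod_eq_foldl[OF assms(1), of "a @ [i]"]
      assms(3) by simp
qed

text \<open>A letter on the left of \<open>u\<close> can be moved past the right multiplications of
  a word for \<open>v\<close>.\<close>

lemma hecke_prod_left:
  assumes "u permutes {1..n}" "v permutes {1..n}" "i \<in> {1..<n}"
  shows "hecke_prod n (hecke_left i u) v = hecke_left i (hecke_prod n u v)"
proof -
  obtain a where "set a \<subseteq> {1..<n}" "foldl hecke_right id a = v"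
    using ex_reduced_word[OF assms(2)] by blast
  then show ?thesis
    using hecke_prod_eq_foldl[OF assms(1), of a] assms
      hecke_prod_eq_foldl[OF hecke_permutes(2)[OF assms(1,3)], of a]
      foldl_hecke_commute[OF assms(1), of a "[i]"] by simp
qed

text \<open>The inverse of \<open>hecke_left i u\<close> gains the letter on its right, so the
  0-Hecke product of \<open>u\<close> and its inverse is multiplied on both sides. This allows it to
  be followed letter by letter.\<close>

lemma hecke_prod_conj:
  assumes u: "u permutes {1..n}" and i: "i \<in> {1..<n}"
  shows "hecke_prod n (hecke_left i u) (inv (hecke_left i u)) =
    hecke_right (hecke_left i (hecke_prod n u (inv u))) i"
  using assms permutes_inv[OF u]
  by (simp add: inv_hecke_left[OF u i] hecke_prod_right hecke_prod_left hecke_permutes)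

section \<open>Minimal length of the elements with a given 0-Hecke square\<close>

text \<open>Since \<open>y = inv y\<close>, a descent is one on both sides, so neither
  multiplication acts.\<close>

lemma hecke_conj_descent:
  assumes y: "involution m y" and i: "i \<in> {1..<m}" and desc: "y (Suc i) < y i"
  shows "hecke_right (hecke_left i y) i = y"
proof -
  have p: "y permutes {1..m}" and inv: "inv y = y"
    using y by (auto simp: involution_def)
  show ?thesis
    using desc by (simp add: hecke_left_eq[OF p i] inv hecke_right_eq[OF p i])
qed

text \<open>An ascent of \<open>y\<close> is one on both sides, so the left multiplication acts. The
  right one acts as well unless \<open>t \<circ> y\<close> has a descent at \<open>i\<close>, which
  happens only if \<open>y\<close> fixes both points: there \<open>t\<close> and \<open>y\<close>
  commute and the length grows by one only.\<close>

lemma hecke_conj_ascent: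
  assumes y: "involution m y" and i: "i \<in> {1..<m}" and asc: "y i < y (Suc i)"
  defines "t \<equiv> transpose i (Suc i)"
  shows "hecke_right (hecke_left i y) i =
      (if y i = i \<and> y (Suc i) = Suc i then t \<circ> y else t \<circ> y \<circ> t)"
    and "coxeter_length (hecke_right (hecke_left i y) i) =
      (if y i = i \<and> y (Suc i) = Suc i then coxeter_length y + 1 else coxeter_length y + 2)"
proof -
  have p: "y permutes {1..m}" and inv: "inv y = y"
    using y by (auto simp: involution_def)
  have ty: "hecke_left i y = t \<circ> y" "t \<circ> y permutes {1..m}"
    using asc permutes_comp_transpose(2)[OF p i]
    by (simp_all add: hecke_left_eq[OF p i] inv t_def)
  have len: "coxeter_length (t \<circ> y) = Suc (coxeter_length y)"
    using coxeter_length_ascent[OF p asc] coxeter_length_inv[OF ty(2)]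
    by (simp add: t_def inv_comp_transpose(2)[OF p] inv)
  have fix_iff: "{y i, y (Suc i)} = {i, Suc i} \<longleftrightarrow> y i = i \<and> y (Suc i) = Suc i"
    using asc by (auto simp: doubleton_eq_iff)
  have "(t \<circ> y) i < (t \<circ> y) (Suc i) \<longleftrightarrow> \<not> (y i = i \<and> y (Suc i) = Suc i)"
  proof (cases "y i = i \<and> y (Suc i) = Suc i")
    case True
    then show ?thesis by (simp add: t_def)
  next
    case False
    then show ?thesis
      using asc fix_iff transpose_Suc_less_iff[of "y i" "y (Suc i)" i] by (simp add: t_def)
  qed
  then show "hecke_right (hecke_left i y) i =
    (if y i = i \<and> y (Suc i) = Suc i then t \<circ> y else t \<circ> y \<circ> t)"
  and "coxeter_length (hecke_right (hecke_left i y) i) =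
    (if y i = i \<and> y (Suc i) = Suc i then coxeter_length y + 1 else coxeter_length y + 2)"
    using coxeter_length_ascent[OF ty(2), of i] len
    unfolding ty(1) hecke_right_eq[OF ty(2) i] by (simp_all add: t_def)
qed

lemma involution_apply:
  assumes "involution m y"
  shows "y (y x) = x"
  using assms permutes_inverses(1)[of y "{1..m}" x] by (simp add: involution_def)

lemma involutionI:
  assumes "y permutes {1..m}" "\<And>x. y (y x) = x"
  shows "involution m y"
  unfolding involution_def using assms inv_equality[of y y] by simp

text \<open>A pair in \<open>Cyc\<close> is determined by its second entry, which for an involution
  is the least point of a cycle.\<close>

lemma card_Cyc: "card (Cyc m y) = card {i \<in> {1..m}. i \<le> y i}"
proof -
  have "Cyc m y = (\<lambda>i. (y i, i)) ` {i \<in> {1..m}. i \<le> y i}"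
    by (auto simp: Cyc_def)
  then show ?thesis by (simp add: card_image inj_on_def)
qed

text \<open>If \<open>y\<close> fixes both points, the length grows by 1 and two fixed points merge
  into one cycle. Otherwise the length grows by 2 and conjugation keeps the number of cycles. The
  quantity rises by 1 either way.\<close>

lemma hecke_conj_ascent_involution:
  assumes y: "involution m y" and i: "i \<in> {1..<m}" and asc: "y i < y (Suc i)"
  shows "involution m (hecke_right (hecke_left i y) i)" (is "involution m ?z")
    and "inv_length m (hecke_right (hecke_left i y) i) = inv_length m y + 1"
proof -
  let ?t = "transpose i (Suc i)"
  have p: "y permutes {1..m}" using y by (simp add: involution_def)
  have pz: "?z permutes {1..m}" using hecke_permutes p i by simp
  have "involution m ?z \<and> inv_length m ?z = inv_length m y + 1"
  proof (cases "y i = i \<and> y (Suc i) = Suc i")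
    case True
    then have z: "?z = ?t \<circ> y" and len: "coxeter_length ?z = coxeter_length y + 1"
      using hecke_conj_ascent[OF assms] by simp_all
    have "y (?t x) = ?t (y x)" for x
      using True involution_apply[OF y, of x] by (auto simp: transpose_def)
    then have "?z (?z x) = x" for x
      by (simp add: z involution_apply[OF y])
    then have inv: "involution m ?z" by (rule involutionI[OF pz])
    \<comment> \<open>\<open>i\<close> stays the lower point of its cycle, while
      \<open>Suc i\<close> becomes the upper point of the new cycle and drops out of the
      count.\<close>
    have A: "{j \<in> {1..m}. j \<le> y j} = insert (Suc i) {j \<in> {1..m}. j \<le> ?z j}"
      (is "?A = insert _ ?B")
    proof -
      have "j \<le> y j \<longleftrightarrow> j = Suc i \<or> j \<le> ?z j" for j
      proof (cases "j = i \<or> j = Suc i")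
        case False
        then have "y j \<noteq> i" "y j \<noteq> Suc i"
          using True involution_apply[OF y, of j] by auto
        then show ?thesis using False by (simp add: z)
      qed (use True in \<open>auto simp: z\<close>)
      then show ?thesis using i by auto
    qed
    have "Suc i \<notin> ?B" using True by (simp add: z)
    then have card: "card ?A = Suc (card ?B)"
      unfolding A by (intro card_insert_disjoint) simp_all
    have "inv_length m ?z = inv_length m y + 1"
      unfolding inv_length_def card_Cyc card len by (simp only: of_nat_Suc of_nat_add of_nat_1) (simp add: field_simps)
    with inv show ?thesis by blast
  next
    case False
    then have z: "?z = ?t \<circ> y \<circ> ?t" and len: "coxeter_length ?z = coxeter_length y + 2"
      using hecke_conj_ascent[OF assms] by auto
    have "involution m ?z"
      by (rule involutionI[OF pz]) (simp add: z involution_apply[OF y])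
    \<comment> \<open>\<open>{i, Suc i}\<close> is no cycle of \<open>y\<close>, as it would give a
      descent. So the swap keeps the order of the points in every cycle and takes lower points to
      lower points.\<close>
    moreover have "bij_betw ?t {j \<in> {1..m}. j \<le> y j} {j \<in> {1..m}. j \<le> ?z j}"
    proof -
      have "j \<le> y j \<longleftrightarrow> ?t j \<le> ?t (y j)" for j
      proof -
        have "{y j, j} \<noteq> {i, Suc i}"
        proof
          assume "{y j, j} = {i, Suc i}"
          then have "y i = Suc i \<and> y (Suc i) = i"
            using involution_apply[OF y, of j] by (auto simp: doubleton_eq_iff)
          with asc show False by simp
        qed
        then show ?thesis using transpose_Suc_less_iff[of "y j" j i] by (simp add: not_less[symmetric])
      qed
      moreover have "?t j \<in> {1..m} \<longleftrightarrow> j \<in> {1..m}" for j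
        using permutes_in_image[OF permutes_swap_id[of i "{1..m}" "Suc i"], of j] i by simp
      ultimately show ?thesis
        by (intro bij_betw_byWitness[where f' = ?t]) (auto simp: z image_subset_iff)
    qed
    ultimately show ?thesis
      using len bij_betw_same_card by (force simp: inv_length_def card_Cyc)
  qed
  then show "involution m ?z" "inv_length m ?z = inv_length m y + 1" by simp_all
qed

lemma inv_length_id: "inv_length m id = 0"
proof -
  have "{i \<in> {1..m}. i \<le> id i} = {1..m}" by auto
  then show ?thesis unfolding inv_length_def card_Cyc coxeter_length_id by simp
qed

lemma involution_id: "involution m id"
  by (rule involutionI) (simp_all add: permutes_id)

text \<open>A reduced word for \<open>inv u\<close> builds \<open>u\<close> from the identity by
  left multiplications. Each letter conjugates the square, which stays an involution, and raises
  \<open>inv_length\<close> by at most 1, starting from 0.\<close>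

lemma inv_length_le:
  assumes u: "u permutes {1..m}"
  shows "involution m (hecke_prod m u (inv u))"
    and "inv_length m (hecke_prod m u (inv u)) \<le> of_nat (coxeter_length u)"
proof -
  obtain a where a: "set a \<subseteq> {1..<m}" "foldl hecke_right id a = inv u"
      "length a = coxeter_length (inv u)"
    using ex_reduced_word[OF permutes_inv[OF u]] by blast
  have u_eq: "u = foldl (\<lambda>x i. hecke_left i x) id a"
    using inv_foldl_hecke_right[OF permutes_id a(1)] permutes_inv_inv[OF u]
    unfolding a(2) inv_id by (simp only:)
  have "involution m (hecke_prod m w (inv w)) \<and>
      inv_length m (hecke_prod m w (inv w)) \<le> of_nat (length a)"
    if "set a \<subseteq> {1..<m}" "w = foldl (\<lambda>x i. hecke_left i x) id a" for a w
    using that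
  proof (induction a arbitrary: w rule: rev_induct)
    case Nil
    have "w = id" using Nil(2) by (simp add: id_def)
    then show ?case
      unfolding inv_id \<open>w = id\<close> hecke_prod_id inv_length_id by (intro conjI involution_id) simp
  next
    case (snoc i a)
    define v where "v = foldl (\<lambda>x i. hecke_left i x) id a"
    let ?y = "hecke_prod m v (inv v)"
    have a: "set a \<subseteq> {1..<m}" and i: "i \<in> {1..<m}" using snoc.prems by auto
    have y: "involution m ?y" and len: "inv_length m ?y \<le> of_nat (length a)"
      using snoc.IH[OF a v_def] by blast+
    have w: "w = hecke_left i v" using snoc.prems(2) unfolding v_def foldl_append by simp
    have conj: "hecke_prod m w (inv w) = hecke_right (hecke_left i ?y) i"
      unfolding w by (rule hecke_prod_conj[OF foldl_hecke_permutes(2)[OF permutes_id a, folded v_def] i])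
    have "?y i \<noteq> ?y (Suc i)"
      using involution_apply[OF y] by (metis n_not_Suc_n)
    then consider "?y i < ?y (Suc i)" | "?y (Suc i) < ?y i" by linarith
    then show ?case
    proof cases
      case 1
      show ?thesis
        unfolding conj using hecke_conj_ascent_involution[OF y i 1] len by simp
    next
      case 2
      show ?thesis
        unfolding conj hecke_conj_descent[OF y i 2] using y len by simp
    qed
  qed
  from this[OF a(1) u_eq] show "involution m (hecke_prod m u (inv u))"
    and "inv_length m (hecke_prod m u (inv u)) \<le> of_nat (coxeter_length u)"
    unfolding a(3) coxeter_length_inv[OF u] by blast+
qed

lemma coxeter_length_hecke_left_le:
  assumes w: "w permutes {1..n}" and i: "i \<in> {1..<n}"
  shows "coxeter_length (hecke_left i w) \<le> Suc (coxeter_length w)"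
proof -
  have "coxeter_length (hecke_right (inv w) i) \<le> Suc (coxeter_length (inv w))"
    using coxeter_length_ascent[OF permutes_inv[OF w], of i]
    by (simp add: hecke_right_eq[OF permutes_inv[OF w] i])
  then show ?thesis
    using coxeter_length_inv[OF w] coxeter_length_inv[OF hecke_permutes(2)[OF w i]]
    by (simp add: inv_hecke_left[OF w i])
qed

text \<open>Undoes an ascending conjugation. If \<open>y\<close> exchanges \<open>i\<close> and
  \<open>Suc i\<close>, splitting this cycle into two fixed points gives \<open>x\<close>; otherwise
  \<open>x\<close> is the ordinary conjugate of \<open>y\<close>.\<close>

lemma involution_descent:
  assumes y: "involution m y" and i: "i \<in> {1..<m}" and desc: "y (Suc i) < y i"
  shows "\<exists>x. involution m x \<and> x i < x (Suc i) \<and> hecke_right (hecke_left i x) i = y"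
proof -
  let ?t = "transpose i (Suc i)"
  have p: "y permutes {1..m}" using y by (simp add: involution_def)
  show ?thesis
  proof (cases "y i = Suc i")
    case True
    then have y': "y (Suc i) = i" using involution_apply[OF y, of i] by simp
    let ?x = "?t \<circ> y"
    have "y (?t j) = ?t (y j)" for j
      using True y' involution_apply[OF y, of j] by (auto simp: transpose_def)
    then have "?x (?x j) = j" for j
      by (simp add: involution_apply[OF y])
    then have x: "involution m ?x" 
      by (rule involutionI[OF permutes_comp_transpose(2)[OF p i]])
    moreover have asc: "?x i < ?x (Suc i)" using True y' by simp
    moreover have "hecke_right (hecke_left i ?x) i = y"
      using True y' unfolding hecke_conj_ascent(1)[OF x i asc]
      by (simp add: fun_eq_iff)
    ultimately show ?thesis by blast
  next
    case False
    let ?x = "?t \<circ> y \<circ> ?t"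
    have ne: "{y (Suc i), y i} \<noteq> {i, Suc i}"
      using False desc by (auto simp: doubleton_eq_iff)
    have "?x permutes {1..m}"
      by (intro permutes_comp_transpose[OF _ i] p)
    then have x: "involution m ?x"
      by (rule involutionI) (simp add: involution_apply[OF y])
    moreover have asc: "?x i < ?x (Suc i)"
      using transpose_Suc_less_iff[OF ne] desc by simp
    \<comment> \<open>Selects the conjugation case of the ascent formula: if \<open>?x\<close> fixed
      both points, so would \<open>y\<close>, against the descent.\<close>
    moreover have "\<not> (?x i = i \<and> ?x (Suc i) = Suc i)"
      using desc by (auto simp: transpose_def split: if_splits)
    then have "hecke_right (hecke_left i ?x) i = ?t \<circ> ?x \<circ> ?t"
      using hecke_conj_ascent(1)[OF x i asc] by argo
    then have "hecke_right (hecke_left i ?x) i = y"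
      by (simp add: fun_eq_iff)
    ultimately show ?thesis by blast
  qed
qed

text \<open>Go down to the identity along descents and come back up. Each step up adds exactly 1 to
  \<open>inv_length\<close> and at most 1 to the length of the element; the lower bound
  \<open>inv_length_le\<close> then forces equality.\<close>

lemma ex_atom:
  assumes "involution m y"
  shows "\<exists>u. u permutes {1..m} \<and> hecke_prod m u (inv u) = y \<and>
    of_nat (coxeter_length u) = inv_length m y"
  using assms
proof (induction "coxeter_length y" arbitrary: y rule: less_induct)
  case less
  have p: "y permutes {1..m}" using less.prems by (simp add: involution_def)
  show ?case
  proof (cases "y = id")
    case True
    show ?thesis
      unfolding True
      by (rule exI[of _ id])
        (simp only: inv_id hecke_prod_id inv_length_id coxeter_length_id permutes_id of_nat_0 simp_thms)
  next
    case False
    then obtain i where i: "i \<in> {1..<m}" "y (Suc i) < y i"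
      using ex_descent[OF p] by blast
    obtain x where x: "involution m x" "x i < x (Suc i)" "hecke_right (hecke_left i x) i = y"
      using involution_descent[OF less.prems i] by blast
    have "coxeter_length x < coxeter_length y"
      using hecke_conj_ascent(2)[OF x(1) i(1) x(2)] unfolding x(3) by (simp split: if_splits)
    then obtain u where u: "u permutes {1..m}" "hecke_prod m u (inv u) = x"
      "of_nat (coxeter_length u) = inv_length m x"
      using less.hyps[OF _ x(1)] by blast
    let ?w = "hecke_left i u"
    have w: "?w permutes {1..m}" by (rule hecke_permutes(2)[OF u(1) i(1)])
    have y: "hecke_prod m ?w (inv ?w) = y"
      unfolding hecke_prod_conj[OF u(1) i(1)] u(2) x(3) ..
    have "of_nat (coxeter_length ?w) \<le> (of_nat (coxeter_length u) + 1 :: rat)"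
      using coxeter_length_hecke_left_le[OF u(1) i(1)] by (metis of_nat_Suc of_nat_le_iff add.commute)
    then have "of_nat (coxeter_length ?w) \<le> inv_length m y"
      using hecke_conj_ascent_involution(2)[OF x(1) i(1) x(2)] unfolding x(3) u(3) by simp
    moreover have "inv_length m y \<le> of_nat (coxeter_length ?w)"
      using inv_length_le(2)[OF w] unfolding y .
    ultimately show ?thesis using w y by (intro exI[of _ ?w]) simp
  qed
qed

section \<open>Words and standardization\<close>

lemma perm_of_word_permutes:
  assumes "Q \<in> permutations_of_set {1..n}"
  shows "perm_of_word Q permutes {1..n}"
proof -
  have Q: "set Q = {1..n}" "distinct Q" "length Q = n"
    using permutations_of_setD[OF assms] length_finite_permutations_of_set[OF assms] by simp_all
  have "bij_betw (\<lambda>i. i - 1) {1..n} {..<n}"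
    by (rule bij_betw_byWitness[where f' = Suc]) auto
  moreover have "bij_betw ((!) Q) {..<n} {1..n}"
    using bij_betw_nth[OF Q(2), of "{..<n}" "{1..n}"] Q by simp
  ultimately have "bij_betw ((!) Q \<circ> (\<lambda>i. i - 1)) {1..n} {1..n}"
    by (rule bij_betw_trans)
  then have "bij_betw (perm_of_word Q) {1..n} {1..n}"
    by (rule bij_betw_cong[THEN iffD1, rotated]) (simp add: perm_of_word_def Q)
  then show ?thesis
    by (rule bij_imp_permutes) (auto simp: perm_of_word_def Q(3))
qed

lemma length_one_line [simp]: "length (one_line n w) = n"
  by (simp add: one_line_def)

lemma nth_one_line: "j < n \<Longrightarrow> one_line n w ! j = w (Suc j)"
  by (simp add: one_line_def plus_1_eq_Suc del: upt_Suc)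

lemma perm_of_word_Suc: "j < length Q \<Longrightarrow> perm_of_word Q (Suc j) = Q ! j"
  by (simp add: perm_of_word_def)

lemma one_line_perm_of_word: "length Q = n \<Longrightarrow> one_line n (perm_of_word Q) = Q"
  by (intro nth_equalityI) (simp_all add: nth_one_line perm_of_word_Suc)

lemma perm_of_word_one_line:
  assumes "w permutes {1..n}"
  shows "perm_of_word (one_line n w) = w"
proof
  fix i
  show "perm_of_word (one_line n w) i = w i"
  proof (cases "i \<in> {1..n}")
    case True
    then obtain j where "i = Suc j" "j < n" by (cases i) auto
    then show ?thesis by (simp add: perm_of_word_Suc nth_one_line)
  next
    case False
    then show ?thesis using permutes_not_in[OF assms False] by (auto simp: perm_of_word_def)
  qed
qed

lemma one_line_permutation:
  assumes "w permutes {1..n}"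
  shows "one_line n w \<in> permutations_of_set {1..n}"
  using permutes_image[OF assms] inj_on_subset[OF permutes_inj[OF assms], of "{1..n}"]
  by (intro permutations_of_setI)
    (simp_all add: one_line_def distinct_map atLeastLessThanSuc_atLeastAtMost del: upt_Suc)

section \<open>Ranks and standardization\<close>

lemma rank_less_iff:
  assumes "finite A" "x \<in> A" "y \<in> A"
  shows "rank A x < rank A y \<longleftrightarrow> x < y"
proof -
  have less: "rank A x < rank A y" if "x < y" "y \<in> A" for x y
    unfolding rank_def
  proof (rule psubset_card_mono)
    show "finite {z \<in> A. z \<le> y}" using assms(1) by simp
    have "y \<in> {z \<in> A. z \<le> y}" "y \<notin> {z \<in> A. z \<le> x}" using that by auto
    moreover have "{z \<in> A. z \<le> x} \<subseteq> {z \<in> A. z \<le> y}" using that by auto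
    ultimately show "{z \<in> A. z \<le> x} \<subset> {z \<in> A. z \<le> y}" by blast
  qed
  show ?thesis using less[of x y] less[of y x] assms by (cases x y rule: linorder_cases) auto
qed

lemma rank_inj_on: "finite A \<Longrightarrow> inj_on (rank A) A"
  using rank_less_iff by (intro inj_onI) (metis less_irrefl linorder_neqE_nat)

lemma bij_betw_rank:
  assumes "finite A"
  shows "bij_betw (rank A) A {1..card A}"
proof -
  have "rank A ` A \<subseteq> {1..card A}"
  proof (rule image_subsetI)
    fix x assume "x \<in> A"
    then have "rank A x \<noteq> 0" using assms by (auto simp: rank_def)
    moreover have "rank A x \<le> card A" unfolding rank_def by (rule card_mono[OF assms]) auto
    ultimately show "rank A x \<in> {1..card A}" by simp
  qed
  moreover have "card (rank A ` A) = card {1..card A}"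
    using card_image[OF rank_inj_on[OF assms]] by simp
  ultimately have "rank A ` A = {1..card A}" by (intro card_subset_eq) simp_all
  then show ?thesis using rank_inj_on[OF assms] by (simp add: bij_betw_def)
qed

text \<open>Only \<open>Suc a\<close> itself is counted in addition. Adjacent letters of a word thus
  get adjacent ranks, and a generator acting on letters becomes a generator acting on the
  standardization.\<close>

lemma rank_Suc:
  assumes "finite A" "Suc a \<in> A"
  shows "rank A (Suc a) = Suc (rank A a)"
proof -
  have "{y \<in> A. y \<le> Suc a} = insert (Suc a) {y \<in> A. y \<le> a}" using assms(2) by auto
  then show ?thesis using assms(1) by (simp add: rank_def)
qed

lemma rank_image:
  assumes "\<And>x y. x \<in> A \<Longrightarrow> y \<in> A \<Longrightarrow> f x < f y \<longleftrightarrow> x < y" "x \<in> A"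
  shows "rank (f ` A) (f x) = rank A x"
proof -
  have "{y \<in> f ` A. y \<le> f x} = f ` {y \<in> A. y \<le> x}"
    using assms by (auto simp: not_less[symmetric])
  moreover have "inj_on f A"
    using assms(1) by (intro inj_onI) (metis less_irrefl linorder_neqE_nat)
  then have "inj_on f {y \<in> A. y \<le> x}" by (rule inj_on_subset) auto
  ultimately show ?thesis by (simp add: rank_def card_image)
qed

lemma rank_word_permutation:
  assumes "distinct Q"
  shows "map (rank (set Q)) Q \<in> permutations_of_set {1..length Q}"
  using bij_betw_rank[of "set Q"] assms
  by (intro permutations_of_setI) (simp_all add: bij_betw_def distinct_map distinct_card)

lemma std_permutes: "distinct Q \<Longrightarrow> std Q permutes {1..length Q}"
  unfolding std_def by (rule perm_of_word_permutes[OF rank_word_permutation])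

lemma std_Suc: "j < length Q \<Longrightarrow> std Q (Suc j) = rank (set Q) (Q ! j)"
  by (simp add: std_def perm_of_word_Suc)

lemma std_outside: "i \<notin> {1..length Q} \<Longrightarrow> std Q i = i"
  unfolding std_def perm_of_word_def length_map by (rule if_not_P)

lemma std_eqI:
  assumes "w permutes {1..length Q}"
    and "\<And>j. j < length Q \<Longrightarrow> w (Suc j) = rank (set Q) (Q ! j)"
  shows "std Q = w"
proof
  fix i
  show "std Q i = w i"
  proof (cases "i \<in> {1..length Q}")
    case True
    then obtain j where "i = Suc j" "j < length Q" by (cases i) auto
    then show ?thesis using assms(2) by (simp add: std_Suc)
  next
    case False
    then show ?thesis using permutes_not_in[OF assms(1) False] std_outside[OF False] by simp
  qed
qed

lemma std_inject:
  assumes "set Q = set Q'" "length Q = length Q'" "std Q = std Q'"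
  shows "Q = Q'"
proof (rule nth_equalityI[OF assms(2)])
  fix j assume j: "j < length Q"
  then have "rank (set Q) (Q ! j) = rank (set Q) (Q' ! j)"
    using std_Suc[of j Q] std_Suc[of j Q'] assms by simp
  moreover have "Q ! j \<in> set Q" using j by simp
  moreover have "Q' ! j \<in> set Q" unfolding assms(1) using j assms(2) by simp
  ultimately show "Q ! j = Q' ! j" using inj_onD[OF rank_inj_on[of "set Q"]] by blast
qed

text \<open>Replaces each entry of \<open>u\<close> by the element of \<open>A\<close> that has this
  rank.\<close>

lemma ex_std:
  assumes A: "finite A" and u: "u permutes {1..card A}"
  shows "\<exists>Q \<in> permutations_of_set A. std Q = u"
proof -
  let ?g = "inv_into A (rank A)"
  have g: "bij_betw ?g {1..card A} A" by (rule bij_betw_inv_into[OF bij_betw_rank[OF A]])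
  let ?Q = "map ?g (one_line (card A) u)"
  have u': "set (one_line (card A) u) = {1..card A}" "distinct (one_line (card A) u)"
    using permutations_of_setD[OF one_line_permutation[OF u]] by simp_all
  have Q: "?Q \<in> permutations_of_set A"
    using g u' by (intro permutations_of_setI) (simp_all add: bij_betw_def distinct_map)
  have set: "set ?Q = A" by (rule permutations_of_setD(1)[OF Q])
  have "std ?Q = u"
  proof (rule std_eqI)
    show "u permutes {1..length ?Q}" using u by simp
    fix j assume "j < length ?Q"
    then have j: "j < card A" by simp
    then have "u (Suc j) \<in> {1..card A}" using permutes_in_image[OF u, of "Suc j"] by auto
    then have "rank A (?g (u (Suc j))) = u (Suc j)"
      using bij_betw_rank[OF A] by (intro f_inv_into_f) (simp add: bij_betw_def)
    then show "u (Suc j) = rank (set ?Q) (?Q ! j)"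
      unfolding set using j by (simp add: nth_one_line)
  qed
  with Q show ?thesis by blast
qed

lemma std_map:
  assumes "distinct Q" "\<And>x y. x \<in> set Q \<Longrightarrow> y \<in> set Q \<Longrightarrow> f x < f y \<longleftrightarrow> x < y"
  shows "std (map f Q) = std Q"
proof (rule std_eqI)
  show "std Q permutes {1..length (map f Q)}" using std_permutes[OF assms(1)] by simp
  show "std Q (Suc j) = rank (set (map f Q)) (map f Q ! j)" if "j < length (map f Q)" for j
    using that rank_image[of "set Q" f "Q ! j", OF assms(2)] by (simp add: std_Suc)
qed

lemma rank_Suc_bounds:
  assumes "distinct Q" "a \<in> set Q" "Suc a \<in> set Q"
  shows "rank (set Q) a \<in> {1..<length Q}"
  using bij_betw_apply[OF bij_betw_rank[of "set Q"] assms(2)]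
    bij_betw_apply[OF bij_betw_rank[of "set Q"] assms(3)] rank_Suc[of "set Q" a] assms
  by (simp add: distinct_card)

text \<open>The ranks of \<open>a\<close> and \<open>Suc a\<close> are adjacent and the set of
  letters stays the same, so exchanging the letters exchanges these two ranks.\<close>

lemma std_map_transpose:
  assumes "distinct Q" "a \<in> set Q" "Suc a \<in> set Q"
  shows "std (map (transpose a (Suc a)) Q) =
    transpose (rank (set Q) a) (Suc (rank (set Q) a)) \<circ> std Q"
proof (rule std_eqI)
  let ?t = "transpose a (Suc a)" and ?r = "rank (set Q) a"
  have set: "set (map ?t Q) = set Q" using assms by simp
  show "transpose ?r (Suc ?r) \<circ> std Q permutes {1..length (map ?t Q)}"
    using permutes_comp_transpose(2)[OF std_permutes rank_Suc_bounds] assms by simp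
  show "(transpose ?r (Suc ?r) \<circ> std Q) (Suc j) = rank (set (map ?t Q)) (map ?t Q ! j)"
    if "j < length (map ?t Q)" for j
  proof -
    have j: "Q ! j \<in> set Q" using that by simp
    have "rank (set Q) (?t x) = transpose ?r (Suc ?r) (rank (set Q) x)" if "x \<in> set Q" for x
      using that assms rank_Suc[of "set Q" a] inj_onD[OF rank_inj_on[of "set Q"], of x]
      by (auto simp: transpose_def)
    from this[OF j] show ?thesis unfolding set using that by (simp add: std_Suc)
  qed
qed

section \<open>Length of a concatenation\<close>

text \<open>A recursion in place of a count of index pairs, because it splits along
  concatenations.\<close>

fun word_length :: "nat list \<Rightarrow> nat" where
  "word_length [] = 0"
| "word_length (x # xs) = length (filter (\<lambda>y. y < x) xs) + word_length xs"

text \<open>Takes sets in place of words, so permutations with the same letters in each block have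
  the same value by rewriting alone.\<close>

fun cross_inversions :: "nat set list \<Rightarrow> nat" where
  "cross_inversions [] = 0"
| "cross_inversions (A # As) = (\<Sum>x\<in>A. card {y \<in> \<Union>(set As). y < x}) + cross_inversions As"

lemma card_inversions_word:
  "card {(i, j). i < j \<and> j < length xs \<and> xs ! j < xs ! i} = word_length xs"
proof (induction xs)
  case (Cons x xs)
  let ?I = "{(i, j). i < j \<and> j < length xs \<and> xs ! j < xs ! i}"
  let ?J = "{j. j < length xs \<and> xs ! j < x}"
  have "{(i, j). i < j \<and> j < length (x # xs) \<and> (x # xs) ! j < (x # xs) ! i} =
      (\<lambda>j. (0, Suc j)) ` ?J \<union> map_prod Suc Suc ` ?I" (is "?L = ?R")
  proof
    show "?L \<subseteq> ?R"
    proof (rule subrelI)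
      fix i j assume "(i, j) \<in> ?L"
      then have *: "i < j" "j < length (x # xs)" "(x # xs) ! j < (x # xs) ! i" by auto
      then obtain j' where j: "j = Suc j'" by (cases j) auto
      show "(i, j) \<in> ?R"
      proof (cases i)
        case 0
        then show ?thesis using * j by auto
      next
        case (Suc i')
        then have "(i', j') \<in> ?I" using * j by simp
        then show ?thesis unfolding j Suc by (intro UnI2) force
      qed
    qed
  qed auto
  moreover have "finite ?I"
    by (rule finite_subset[of _ "{..<length xs} \<times> {..<length xs}"]) auto
  moreover have "(\<lambda>j. (0, Suc j)) ` ?J \<inter> map_prod Suc Suc ` ?I = {}" by auto
  moreover have "card ((\<lambda>j. (0::nat, Suc j)) ` ?J) = card ?J"
    by (rule card_image) (simp add: inj_on_def)
  moreover have "card (map_prod Suc Suc ` ?I) = card ?I"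
    by (rule card_image) (auto simp: inj_on_def)
  ultimately show ?case
    using Cons.IH by (simp add: card_Un_disjoint length_filter_conv_card)
qed simp

lemma coxeter_length_perm_of_word:
  assumes "Q \<in> permutations_of_set {1..n}"
  shows "coxeter_length (perm_of_word Q) = word_length Q"
proof -
  let ?w = "perm_of_word Q"
  have w: "?w permutes {1..n}" by (rule perm_of_word_permutes[OF assms])
  have len: "length Q = n" using length_finite_permutations_of_set[OF assms] by simp
  have "{(i, j). i < j \<and> ?w j < ?w i} =
      map_prod Suc Suc ` {(i, j). i < j \<and> j < length Q \<and> Q ! j < Q ! i}" (is "?L = ?R")
  proof
    show "?L \<subseteq> ?R"
    proof (rule subrelI)
      fix i j assume "(i, j) \<in> ?L"
      then have ij: "i < j" "?w j < ?w i" by auto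
      have "i \<noteq> 0" "j \<le> n" using inversion_bounds[OF w ij] by simp_all
      obtain i' j' where ij': "i = Suc i'" "j = Suc j'" using ij(1) \<open>i \<noteq> 0\<close> by (cases i; cases j) auto
      then have "(i', j') \<in> {(i, j). i < j \<and> j < length Q \<and> Q ! j < Q ! i}"
        using ij \<open>j \<le> n\<close> by (simp add: perm_of_word_Suc len)
      then show "(i, j) \<in> ?R" unfolding ij' by force
    qed
    show "?R \<subseteq> ?L" by (auto simp: perm_of_word_Suc)
  qed
  then have "coxeter_length ?w = card {(i, j). i < j \<and> j < length Q \<and> Q ! j < Q ! i}"
    unfolding coxeter_length_def by (simp add: card_image inj_on_def)
  then show ?thesis unfolding card_inversions_word .
qed

lemma word_length_map:
  assumes "\<And>x y. x \<in> set Q \<Longrightarrow> y \<in> set Q \<Longrightarrow> f x < f y \<longleftrightarrow> x < y"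
  shows "word_length (map f Q) = word_length Q"
  using assms
proof (induction Q)
  case (Cons x Q)
  have "filter (\<lambda>y. f y < f x) Q = filter (\<lambda>y. y < x) Q"
    using Cons.prems by (intro filter_cong) auto
  then show ?case using Cons by (simp add: filter_map comp_def)
qed simp

lemma coxeter_length_std:
  assumes "distinct Q"
  shows "coxeter_length (std Q) = word_length Q"
  unfolding std_def coxeter_length_perm_of_word[OF rank_word_permutation[OF assms]]
  by (rule word_length_map) (simp add: rank_less_iff)

lemma word_length_append:
  "word_length (xs @ ys) =
    word_length xs + word_length ys + (\<Sum>x\<leftarrow>xs. length (filter (\<lambda>y. y < x) ys))"
  by (induction xs) simp_all

text \<open>An inversion lies within one word or between two. Distinctness turns the counts of
  letters between words into cardinalities of sets.\<close>

lemma word_length_concat: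
  assumes "distinct (concat Qs)"
  shows "word_length (concat Qs) = cross_inversions (map set Qs) + (\<Sum>Q\<leftarrow>Qs. word_length Q)"
  using assms
proof (induction Qs)
  case (Cons Q Qs)
  have "length (filter (\<lambda>y. y < x) (concat Qs)) = card {y \<in> \<Union>(set (map set Qs)). y < x}" for x
    using Cons.prems distinct_card[of "filter (\<lambda>y. y < x) (concat Qs)"] by simp
  then have "(\<Sum>x\<leftarrow>Q. length (filter (\<lambda>y. y < x) (concat Qs))) =
      (\<Sum>x\<in>set Q. card {y \<in> \<Union>(set (map set Qs)). y < x})"
    using Cons.prems by (simp add: sum_list_distinct_conv_sum_set)
  then show ?case using Cons by (simp add: word_length_append)
qed simp

section \<open>Blocks\<close>

lemma length_block [simp]: "length (block \<mu> w r) = \<mu> ! r"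
  by (simp add: block_def Let_def del: upt_Suc)

lemma nth_block: "j < \<mu> ! r \<Longrightarrow> block \<mu> w r ! j = w (sum_list (take r \<mu>) + Suc j)"
  by (simp add: block_def Let_def One_nat_def del: upt_Suc)

lemma block_comp: "block \<mu> (f \<circ> w) r = map f (block \<mu> w r)"
  by (simp add: block_def Let_def)

lemma length_blocks [simp]: "length (blocks \<mu> w) = length \<mu>"
  by (simp add: blocks_def)

lemma nth_blocks: "r < length \<mu> \<Longrightarrow> blocks \<mu> w ! r = block \<mu> w r"
  by (simp add: blocks_def)

lemma set_blocks: "set (blocks \<mu> w) = block \<mu> w ` {..<length \<mu>}"
  by (auto simp: blocks_def)

text \<open>Induction from the right, since appending a part to \<open>\<mu>\<close> keeps the
  offsets of the earlier blocks, whereas a new first part would shift all of them.\<close>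

lemma concat_blocks: "concat (blocks \<mu> w) = one_line (sum_list \<mu>) w"
proof (induction \<mu> rule: rev_induct)
  case Nil
  show ?case by (simp add: blocks_def one_line_def)
next
  case (snoc x \<mu>)
  have "block (\<mu> @ [x]) w r = block \<mu> w r" if "r < length \<mu>" for r
    using that by (simp add: block_def nth_append)
  then have "map (block (\<mu> @ [x]) w) [0..<length \<mu>] = blocks \<mu> w"
    unfolding blocks_def by (intro map_cong) auto
  then have "blocks (\<mu> @ [x]) w = blocks \<mu> w @ [block (\<mu> @ [x]) w (length \<mu>)]"
    unfolding blocks_def[of "\<mu> @ [x]"] by simp
  then have "concat (blocks (\<mu> @ [x]) w) = one_line (sum_list \<mu>) w @ block (\<mu> @ [x]) w (length \<mu>)"
    using snoc.IH by simp
  also have "\<dots> = map w ([1..<Suc (sum_list \<mu>)] @ [Suc (sum_list \<mu>)..<Suc (sum_list \<mu>) + x])"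
    by (simp add: block_def one_line_def Let_def One_nat_def del: upt_Suc)
  also have "\<dots> = map w [1..<Suc (sum_list \<mu>) + x]"
    using upt_add_eq_append[of 1 "Suc (sum_list \<mu>)" x] by (simp del: upt_Suc)
  finally show ?case by (simp add: one_line_def del: upt_Suc)
qed

lemma offset_Suc:
  fixes \<mu> :: "nat list"
  shows "r < length \<mu> \<Longrightarrow> sum_list (take (Suc r) \<mu>) = sum_list (take r \<mu>) + \<mu> ! r"
  by (simp add: take_Suc_conv_app_nth)

lemma offset_mono:
  fixes \<mu> :: "nat list"
  assumes "r \<le> r'"
  shows "sum_list (take r \<mu>) \<le> sum_list (take r' \<mu>)"
proof -
  have "take r' \<mu> = take r \<mu> @ take (r' - r) (drop r \<mu>)"
    using take_add[of r "r' - r" \<mu>] assms by simp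
  then show ?thesis by simp
qed

lemma offset_less:
  fixes \<mu> :: "nat list"
  assumes "r < r'" "r' \<le> length \<mu>"
  shows "sum_list (take r \<mu>) + \<mu> ! r \<le> sum_list (take r' \<mu>)"
  using offset_mono[of "Suc r" r' \<mu>] offset_Suc[of r \<mu>] assms by simp

text \<open>Moves questions about blocks to positions, where blocks are disjoint intervals.\<close>

lemma mem_block_iff:
  assumes "w permutes S"
  shows "x \<in> set (block \<mu> w r) \<longleftrightarrow>
    inv w x \<in> {sum_list (take r \<mu>)<..sum_list (take r \<mu>) + \<mu> ! r}"
proof -
  have "set (block \<mu> w r) = w ` {sum_list (take r \<mu>)<..sum_list (take r \<mu>) + \<mu> ! r}"
    unfolding block_def Let_def set_map by (intro arg_cong[of _ _ "(`) w"]) auto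
  then show ?thesis
    using inj_image_mem_iff[OF permutes_inj[OF assms], of "inv w x"] permutes_inverses(1)[OF assms]
    by simp
qed

lemma block_order:
  assumes "w permutes S" "r < r'" "r' < length \<mu>"
    and "x \<in> set (block \<mu> w r)" "y \<in> set (block \<mu> w r')"
  shows "inv w x < inv w y"
  using offset_less[of r r' \<mu>] assms by (simp add: mem_block_iff[OF assms(1)])

lemma block_unique:
  assumes "w permutes S" "r < length \<mu>" "r' < length \<mu>"
    and "x \<in> set (block \<mu> w r)" "x \<in> set (block \<mu> w r')"
  shows "r = r'"
  using block_order[of w S r r' \<mu> x x] block_order[of w S r' r \<mu> x x] assms
  by (cases r r' rule: linorder_cases) auto

lemma distinct_block:
  assumes "w permutes S"
  shows "distinct (block \<mu> w r)"
  using inj_on_subset[OF permutes_inj[OF assms]] by (simp add: block_def Let_def distinct_map)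

lemma ex_block:
  assumes "w permutes {1..sum_list \<mu>}" "x \<in> {1..sum_list \<mu>}"
  shows "\<exists>r<length \<mu>. x \<in> set (block \<mu> w r)"
proof -
  have "x \<in> set (concat (blocks \<mu> w))"
    using permutations_of_setD(1)[OF one_line_permutation[OF assms(1)]] assms(2)
    unfolding concat_blocks by simp
  then show ?thesis by (auto simp: set_blocks)
qed

lemma inv_std_block:
  assumes w: "w permutes S" and x: "x \<in> set (block \<mu> w r)"
  shows "inv (std (block \<mu> w r)) (rank (set (block \<mu> w r)) x) + sum_list (take r \<mu>) = inv w x"
proof -
  let ?B = "block \<mu> w r"
  \<comment> \<open>The index of \<open>x\<close> in the block, counted from 0.\<close>
  define j where "j = inv w x - sum_list (take r \<mu>) - 1"
  have j: "j < \<mu> ! r" "inv w x = sum_list (take r \<mu>) + Suc j"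
    using x unfolding mem_block_iff[OF w] j_def by auto
  then have "?B ! j = x"
    using permutes_inverses(1)[OF w, of x] by (simp add: nth_block)
  then have "std ?B (Suc j) = rank (set ?B) x"
    using std_Suc[of j ?B] j(1) by simp
  then have "inv (std ?B) (rank (set ?B) x) = Suc j"
    by (simp add: permutes_inv_eq[OF std_permutes[OF distinct_block[OF w]]])
  then show ?thesis using j(2) by simp
qed

lemma blocks_perm_of_word:
  assumes "length Bs = length \<mu>" "\<And>r. r < length \<mu> \<Longrightarrow> length (Bs ! r) = \<mu> ! r"
  shows "blocks \<mu> (perm_of_word (concat Bs)) = Bs"
proof (rule concat_injective)
  have "map length Bs = \<mu>" using assms by (intro nth_equalityI) simp_all
  then have "length (concat Bs) = sum_list \<mu>" by (simp add: length_concat)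
  then show "concat (blocks \<mu> (perm_of_word (concat Bs))) = concat Bs"
    unfolding concat_blocks by (rule one_line_perm_of_word)
  show "\<forall>(x, y) \<in> set (zip (blocks \<mu> (perm_of_word (concat Bs))) Bs). length x = length y"
    using assms by (auto simp: set_zip nth_blocks)
qed (simp add: assms(1))

lemma block_perm_of_word:
  assumes "length Bs = length \<mu>" "\<And>r. r < length \<mu> \<Longrightarrow> length (Bs ! r) = \<mu> ! r" "r < length \<mu>"
  shows "block \<mu> (perm_of_word (concat Bs)) r = Bs ! r"
  using nth_blocks[OF assms(3), of "perm_of_word (concat Bs)"] blocks_perm_of_word[OF assms(1,2)]
  by simp

lemma permutes_eqI_blocks:
  assumes "v permutes {1..sum_list \<mu>}" "w permutes {1..sum_list \<mu>}"
    and "\<And>r. r < length \<mu> \<Longrightarrow> block \<mu> v r = block \<mu> w r"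
  shows "v = w"
proof -
  have "blocks \<mu> v = blocks \<mu> w"
    using assms(3) by (intro nth_equalityI) (simp_all add: nth_blocks)
  from arg_cong[OF this, of concat]
  have "one_line (sum_list \<mu>) v = one_line (sum_list \<mu>) w"
    unfolding concat_blocks .
  from arg_cong[OF this, of perm_of_word] show ?thesis
    unfolding perm_of_word_one_line[OF assms(1)] perm_of_word_one_line[OF assms(2)] .
qed

lemma coxeter_length_blocks:
  assumes "w permutes {1..sum_list \<mu>}"
  shows "coxeter_length w = cross_inversions (map set (blocks \<mu> w)) +
    (\<Sum>r<length \<mu>. coxeter_length (std (block \<mu> w r)))"
proof -
  have perm: "concat (blocks \<mu> w) \<in> permutations_of_set {1..sum_list \<mu>}"
    unfolding concat_blocks by (rule one_line_permutation[OF assms])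
  have "coxeter_length w = word_length (concat (blocks \<mu> w))"
    using coxeter_length_perm_of_word[OF perm] perm_of_word_one_line[OF assms]
    by (simp add: concat_blocks)
  also have "\<dots> = cross_inversions (map set (blocks \<mu> w)) + (\<Sum>B\<leftarrow>blocks \<mu> w. word_length B)"
    by (rule word_length_concat[OF permutations_of_setD(2)[OF perm]])
  also have "(\<Sum>B\<leftarrow>blocks \<mu> w. word_length B) =
      (\<Sum>r<length \<mu>. coxeter_length (std (block \<mu> w r)))"
    by (simp add: blocks_def sum_list_distinct_conv_sum_set atLeast0LessThan comp_def
        coxeter_length_std[OF distinct_block[OF assms]])
  finally show ?thesis .
qed

section \<open>The action in terms of blocks\<close>

text \<open>Both letters lie in the same block, whose offset shifts their positions equally. So the
  test of \<open>hecke_left\<close> has the same outcome for \<open>w\<close> and for the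
  standardization.\<close>

lemma std_block_hecke_left:
  assumes w: "w permutes {1..n}" and i: "i \<in> {1..<n}"
    and mem: "i \<in> set (block \<mu> w r)" "Suc i \<in> set (block \<mu> w r)"
  shows "std (block \<mu> (hecke_left i w) r) =
      hecke_left (rank (set (block \<mu> w r)) i) (std (block \<mu> w r))"
    and "set (block \<mu> (hecke_left i w) r) = set (block \<mu> w r)"
proof -
  let ?B = "block \<mu> w r"
  let ?\<rho> = "rank (set ?B) i"
  have dist: "distinct ?B" by (rule distinct_block[OF w])
  have "inv w i < inv w (Suc i) \<longleftrightarrow> inv (std ?B) ?\<rho> < inv (std ?B) (Suc ?\<rho>)"
    using inv_std_block[OF w mem(1)] inv_std_block[OF w mem(2)]
    unfolding rank_Suc[OF finite_set mem(2)] by linarith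
  then show "std (block \<mu> (hecke_left i w) r) = hecke_left ?\<rho> (std ?B)"
    unfolding hecke_left_eq[OF w i] hecke_left_eq[OF std_permutes rank_Suc_bounds, OF dist dist mem]
    by (simp add: block_comp std_map_transpose[OF dist mem])
  show "set (block \<mu> (hecke_left i w) r) = set ?B"
    unfolding hecke_left_eq[OF w i] using mem by (simp add: block_comp)
qed

text \<open>With at most one of the two values in the block, the swap preserves the order of its
  letters.\<close>

lemma std_block_transpose:
  assumes "w permutes S" "\<not> {i, Suc i} \<subseteq> set (block \<mu> w r)"
  shows "std (block \<mu> (transpose i (Suc i) \<circ> w) r) = std (block \<mu> w r)"
  unfolding block_comp
  by (rule std_map[OF distinct_block[OF assms(1)]])
    (rule transpose_Suc_less_iff, use assms(2) in \<open>auto simp: doubleton_eq_iff\<close>)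

text \<open>\<open>ex_std\<close> gives existence and \<open>std_inject\<close> uniqueness for the
  definite description.\<close>

lemma conj_block:
  assumes B: "distinct B" and mem: "i \<in> set B" "Suc i \<in> set B"
  defines "r \<equiv> rank (set B) i"
  shows "conj_block i B \<in> permutations_of_set (set B)"
    and "std (conj_block i B) = hecke_right (hecke_left r (std B)) r"
proof -
  let ?u = "hecke_right (hecke_left r (std B)) r"
  have "r \<in> {1..<length B}" unfolding r_def by (rule rank_Suc_bounds[OF B mem])
  then have "?u permutes {1..card (set B)}"
    unfolding distinct_card[OF B] by (intro hecke_permutes std_permutes[OF B])
  then obtain Q where Q: "Q \<in> permutations_of_set (set B)" "std Q = ?u"
    using ex_std[of "set B"] by blast
  have "conj_block i B = Q"
    unfolding conj_block_def Let_def r_def[symmetric]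
  proof (rule the_equality)
    show "Q \<in> permutations_of_set (set B) \<and> std Q = ?u" using Q by blast
    fix Q' assume Q': "Q' \<in> permutations_of_set (set B) \<and> std Q' = ?u"
    show "Q' = Q"
    proof (rule std_inject)
      show "set Q' = set Q"
        using permutations_of_setD(1)[OF Q(1)] permutations_of_setD(1)[of Q'] Q' by metis
      show "length Q' = length Q"
        using length_finite_permutations_of_set[OF Q(1)] length_finite_permutations_of_set[of Q'] Q'
        by metis
      show "std Q' = std Q" using Q(2) Q' by metis
    qed
  qed
  with Q show "conj_block i B \<in> permutations_of_set (set B)"
    and "std (conj_block i B) = ?u" by simp_all
qed

text \<open>\<open>mu_square \<mu> v \<pi>\<close> describes \<open>\<pi> = e \<circ>\<^sub>\<mu> v\<inverse>\<close> without reference to a word for \<open>v\<inverse>\<close>.\<close>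

definition mu_square :: "nat list \<Rightarrow> (nat \<Rightarrow> nat) \<Rightarrow> (nat \<Rightarrow> nat) \<Rightarrow> bool" where
  "mu_square \<mu> v \<pi> \<longleftrightarrow> v permutes {1..sum_list \<mu>} \<and> \<pi> permutes {1..sum_list \<mu>} \<and>
    (\<forall>r<length \<mu>. set (block \<mu> v r) = set (block \<mu> \<pi> r) \<and>
      std (block \<mu> \<pi> r) =
        hecke_prod (\<mu> ! r) (std (block \<mu> v r)) (inv (std (block \<mu> v r))))"

lemma mu_squareD:
  assumes "mu_square \<mu> v \<pi>"
  shows "v permutes {1..sum_list \<mu>}" "\<pi> permutes {1..sum_list \<mu>}"
    "r < length \<mu> \<Longrightarrow> set (block \<mu> v r) = set (block \<mu> \<pi> r)"
    "r < length \<mu> \<Longrightarrow> std (block \<mu> \<pi> r) =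
      hecke_prod (\<mu> ! r) (std (block \<mu> v r)) (inv (std (block \<mu> v r)))"
  using assms unfolding mu_square_def by simp_all

lemma mu_squareI:
  assumes "v permutes {1..sum_list \<mu>}" "\<pi> permutes {1..sum_list \<mu>}"
    "\<And>r. r < length \<mu> \<Longrightarrow> set (block \<mu> v r) = set (block \<mu> \<pi> r) \<and> std (block \<mu> \<pi> r) =
      hecke_prod (\<mu> ! r) (std (block \<mu> v r)) (inv (std (block \<mu> v r)))"
  shows "mu_square \<mu> v \<pi>"
  using assms unfolding mu_square_def by blast

lemma std_block_permutes:
  assumes "w permutes S"
  shows "std (block \<mu> w r) permutes {1..\<mu> ! r}"
  using std_permutes[OF distinct_block[OF assms], of \<mu> r] by simp

lemma concat_permutation:
  assumes \<pi>: "\<pi> permutes {1..sum_list \<mu>}" and len: "length Bs = length \<mu>"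
    and Bs: "\<And>r. r < length \<mu> \<Longrightarrow> set (Bs ! r) = set (block \<mu> \<pi> r) \<and> length (Bs ! r) = \<mu> ! r"
  shows "concat Bs \<in> permutations_of_set {1..sum_list \<mu>}"
proof -
  have "map set Bs = map set (blocks \<mu> \<pi>)"
    using len Bs by (intro nth_equalityI) (simp_all add: nth_blocks)
  from arg_cong[OF this, of "\<lambda>As. \<Union>(set As)"]
  have "set (concat Bs) = set (concat (blocks \<mu> \<pi>))"
    by (simp only: set_map set_concat)
  then have set: "set (concat Bs) = {1..sum_list \<mu>}"
    unfolding concat_blocks permutations_of_setD(1)[OF one_line_permutation[OF \<pi>]] .
  have "map length Bs = \<mu>" using len Bs by (intro nth_equalityI) simp_all
  then have "length (concat Bs) = sum_list \<mu>" by (simp add: length_concat)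
  \<comment> \<open>As many places as letters leave no room for a repetition.\<close>
  with set have "distinct (concat Bs)" by (intro card_distinct) simp
  with set show ?thesis by (rule permutations_of_setI)
qed

text \<open>The blocks of the identity are runs of consecutive numbers, on which the rank subtracts
  the offset.\<close>

lemma mu_square_id: "mu_square \<mu> id id"
proof (rule mu_squareI)
  fix r
  have "std (block \<mu> id r) = id"
  proof (rule std_eqI)
    fix j assume "j < length (block \<mu> id r)"
    then have j: "j < \<mu> ! r" by simp
    let ?m = "sum_list (take r \<mu>)"
    have "set (block \<mu> id r) = {?m<..?m + \<mu> ! r}"
      by (rule set_eqI) (simp only: mem_block_iff[OF permutes_id[of UNIV]] inv_id id_apply)
    then have "{y \<in> set (block \<mu> id r). y \<le> ?m + Suc j} = {?m<..?m + Suc j}"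
      using j by auto
    then have "rank (set (block \<mu> id r)) (?m + Suc j) = Suc j"
      by (simp add: rank_def)
    moreover have "block \<mu> id r ! j = ?m + Suc j"
      using nth_block[OF j, of id] unfolding id_apply .
    ultimately show "id (Suc j) = rank (set (block \<mu> id r)) (block \<mu> id r ! j)"
      unfolding id_apply by metis
  qed (rule permutes_id)
  then show "set (block \<mu> id r) = set (block \<mu> id r) \<and>
      std (block \<mu> id r) = hecke_prod (\<mu> ! r) (std (block \<mu> id r)) (inv (std (block \<mu> id r)))"
    by (simp only: inv_id hecke_prod_id)
qed (rule permutes_id)+

text \<open>Appending \<open>i\<close> to a word for \<open>w\<close> turns \<open>v = inv w\<close>
  into \<open>hecke_left i v\<close>, so this is the induction step along a word. If both values
  share a block, its square changes by \<open>hecke_prod_conj\<close>.\<close>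

lemma mu_square_step:
  assumes sq: "mu_square \<mu> v \<pi>" and i: "i \<in> {1..<sum_list \<mu>}"
  shows "mu_square \<mu> (hecke_left i v) (mu_act_gen \<mu> \<pi> i)"
proof -
  note v = mu_squareD(1)[OF sq] and \<pi> = mu_squareD(2)[OF sq]
    and sets = mu_squareD(3)[OF sq] and squares = mu_squareD(4)[OF sq]
  show ?thesis
  proof (cases "\<exists>B \<in> set (blocks \<mu> \<pi>). {i, i + 1} \<subseteq> set B")
    case True
    then obtain r where r: "r < length \<mu>" "i \<in> set (block \<mu> \<pi> r)" "Suc i \<in> set (block \<mu> \<pi> r)"
      by (auto simp: set_blocks One_nat_def)
    define Bs where "Bs = map (\<lambda>B. if {i, i + 1} \<subseteq> set B then conj_block i B else B) (blocks \<mu> \<pi>)"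
    have gen: "mu_act_gen \<mu> \<pi> i = perm_of_word (concat Bs)"
      unfolding mu_act_gen_def if_P[OF True] Bs_def ..
    have len: "length Bs = length \<mu>" by (simp add: Bs_def)
    have notin: "i \<notin> set (block \<mu> \<pi> q)" "Suc i \<notin> set (block \<mu> \<pi> q)" if "q < length \<mu>" "q \<noteq> r" for q
      using block_unique[OF \<pi> r(1) that(1) r(2)] block_unique[OF \<pi> r(1) that(1) r(3)] that(2)
      by blast+
    have Bs_r: "Bs ! r = conj_block i (block \<mu> \<pi> r)"
      using r by (simp add: Bs_def nth_blocks One_nat_def)
    have Bs_q: "Bs ! q = block \<mu> \<pi> q" if "q < length \<mu>" "q \<noteq> r" for q
      using that notin[OF that] by (simp add: Bs_def nth_blocks One_nat_def)
    note conj = conj_block[OF distinct_block[OF \<pi>] r(2,3)]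
    have Bs: "set (Bs ! q) = set (block \<mu> \<pi> q) \<and> length (Bs ! q) = \<mu> ! q" if "q < length \<mu>" for q
    proof (cases "q = r")
      case True
      then show ?thesis
        using permutations_of_setD(1)[OF conj(1)] length_finite_permutations_of_set[OF conj(1)]
          distinct_card[OF distinct_block[OF \<pi>, of \<mu> r]] by (simp add: Bs_r)
    qed (simp add: Bs_q that)
    have block: "block \<mu> (perm_of_word (concat Bs)) q = Bs ! q" if "q < length \<mu>" for q
      using block_perm_of_word[OF len _ that] Bs by blast
    show ?thesis
      unfolding gen
    proof (rule mu_squareI)
      show "hecke_left i v permutes {1..sum_list \<mu>}" by (rule hecke_permutes(2)[OF v i])
      show "perm_of_word (concat Bs) permutes {1..sum_list \<mu>}"
        by (rule perm_of_word_permutes[OF concat_permutation[OF \<pi> len Bs]])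
      fix q assume q: "q < length \<mu>"
      show "set (block \<mu> (hecke_left i v) q) = set (block \<mu> (perm_of_word (concat Bs)) q) \<and>
        std (block \<mu> (perm_of_word (concat Bs)) q) = hecke_prod (\<mu> ! q)
          (std (block \<mu> (hecke_left i v) q)) (inv (std (block \<mu> (hecke_left i v) q)))"
      proof (cases "q = r")
        case True
        have mem: "i \<in> set (block \<mu> v r)" "Suc i \<in> set (block \<mu> v r)"
          unfolding sets[OF r(1)] by (rule r(2), rule r(3))
        note left = std_block_hecke_left[OF v i mem]
        have rank: "rank (set (block \<mu> v r)) i \<in> {1..<\<mu> ! r}"
          using rank_Suc_bounds[OF distinct_block[OF v] mem] by simp
        have "set (block \<mu> (hecke_left i v) r) = set (Bs ! r)"
          unfolding left(2) using Bs[OF r(1)] sets[OF r(1)] by simp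
        moreover have "std (Bs ! r) = hecke_prod (\<mu> ! r)
          (std (block \<mu> (hecke_left i v) r)) (inv (std (block \<mu> (hecke_left i v) r)))"
          unfolding left(1) hecke_prod_conj[OF std_block_permutes[OF v] rank]
          unfolding Bs_r conj(2) squares[OF r(1)] sets[OF r(1)] ..
        ultimately show ?thesis unfolding True block[OF r(1)] by blast
      next
        case False
        \<comment> \<open>Blocks are disjoint, so no other block contains either value.\<close>
        have "map (transpose i (Suc i)) (block \<mu> v q) = block \<mu> v q"
          using notin[OF q False] unfolding sets[OF q, symmetric]
          by (intro map_idI) (metis transpose_apply_other)
        then have "block \<mu> (hecke_left i v) q = block \<mu> v q"
          unfolding hecke_left_eq[OF v i] by (simp add: block_comp)
        then show ?thesis
          unfolding block[OF q] Bs_q[OF q False] using sets[OF q] squares[OF q] by simp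
      qed
    qed
  next
    case False
    have apart: "\<not> {i, Suc i} \<subseteq> set (block \<mu> \<pi> q)" if "q < length \<mu>" for q
      using False that by (auto simp: set_blocks One_nat_def)
    obtain r r' where r: "r < length \<mu>" "i \<in> set (block \<mu> \<pi> r)"
      and r': "r' < length \<mu>" "Suc i \<in> set (block \<mu> \<pi> r')"
      using ex_block[OF \<pi>, of i] ex_block[OF \<pi>, of "Suc i"] i by auto
    have "r \<noteq> r'" using apart r r' by blast
    \<comment> \<open>Positions in different blocks compare like the indices of the blocks, and
      \<open>v\<close> and \<open>\<pi>\<close> have the same letters in each block, so both pass
      the test of \<open>hecke_left\<close> or both fail it.\<close>
    have order: "inv w i < inv w (Suc i) \<longleftrightarrow> r < r'"
      if w: "w permutes {1..sum_list \<mu>}" and "i \<in> set (block \<mu> w r)" "Suc i \<in> set (block \<mu> w r')" for w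
      using block_order[OF w _ r'(1) that(2,3)] block_order[OF w _ r(1) that(3,2)] \<open>r \<noteq> r'\<close>
      by (cases r r' rule: linorder_cases) auto
    have mem: "i \<in> set (block \<mu> v r)" "Suc i \<in> set (block \<mu> v r')"
      unfolding sets[OF r(1)] sets[OF r'(1)] by (rule r(2), rule r'(2))
    have gen: "mu_act_gen \<mu> \<pi> i = hecke_left i \<pi>"
      unfolding mu_act_gen_def if_not_P[OF False] ..
    let ?t = "transpose i (Suc i)"
    \<comment> \<open>Covers the outcome in which both are swapped; in the other one nothing changes
      and \<open>sq\<close> applies.\<close>
    have "mu_square \<mu> (?t \<circ> v) (?t \<circ> \<pi>)"
    proof (rule mu_squareI)
      show "?t \<circ> v permutes {1..sum_list \<mu>}" "?t \<circ> \<pi> permutes {1..sum_list \<mu>}"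
        by (rule permutes_comp_transpose(2)[OF v i], rule permutes_comp_transpose(2)[OF \<pi> i])
      fix q assume q: "q < length \<mu>"
      have apart': "\<not> {i, Suc i} \<subseteq> set (block \<mu> v q)"
        unfolding sets[OF q] by (rule apart[OF q])
      show "set (block \<mu> (?t \<circ> v) q) = set (block \<mu> (?t \<circ> \<pi>) q) \<and>
        std (block \<mu> (?t \<circ> \<pi>) q) = hecke_prod (\<mu> ! q)
          (std (block \<mu> (?t \<circ> v) q)) (inv (std (block \<mu> (?t \<circ> v) q)))"
        unfolding std_block_transpose[OF v apart'] std_block_transpose[OF \<pi> apart[OF q]]
        using sets[OF q] squares[OF q] by (simp add: block_comp)
    qed
    then show ?thesis
      unfolding gen hecke_left_eq[OF v i] hecke_left_eq[OF \<pi> i] order[OF v mem] order[OF \<pi> r(2) r'(2)]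
      using sq by simp
  qed
qed

section \<open>Independence of the word\<close>

lemma mu_square_foldl:
  assumes "set a \<subseteq> {1..<sum_list \<mu>}"
  shows "mu_square \<mu> (inv (foldl hecke_right id a)) (foldl (mu_act_gen \<mu>) id a)"
proof -
  have "mu_square \<mu> (foldl (\<lambda>x i. hecke_left i x) v a) (foldl (mu_act_gen \<mu>) \<pi> a)"
    if "mu_square \<mu> v \<pi>" for v \<pi>
    using assms that
  proof (induction a arbitrary: v \<pi>)
    case (Cons i a)
    then show ?case using Cons.IH[OF _ mu_square_step[of \<mu> v \<pi> i]] by simp
  qed simp
  from this[OF mu_square_id] show ?thesis
    unfolding inv_foldl_hecke_right[OF permutes_id assms] inv_id .
qed

text \<open>\<open>v\<close> determines the letters and the standardization of each block, and these
  determine the block.\<close>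

lemma mu_square_unique:
  assumes "mu_square \<mu> v \<pi>" "mu_square \<mu> v \<pi>'"
  shows "\<pi> = \<pi>'"
proof (rule permutes_eqI_blocks[OF mu_squareD(2)[OF assms(1)] mu_squareD(2)[OF assms(2)]])
  fix r assume r: "r < length \<mu>"
  show "block \<mu> \<pi> r = block \<mu> \<pi>' r"
    by (rule std_inject)
      (simp_all add: mu_squareD(3)[OF assms(1) r, symmetric] mu_squareD(3)[OF assms(2) r]
        mu_squareD(4)[OF assms(1) r] mu_squareD(4)[OF assms(2) r])
qed

text \<open>All words for \<open>w\<close> lead to permutations related to \<open>inv w\<close>,
  hence to the same one. So the action extends to \<open>w\<close>, and its value is characterized
  without words.\<close>

lemma mu_act_eq_iff:
  assumes w: "w permutes {1..sum_list \<mu>}"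
  shows "mu_act \<mu> id w = \<pi> \<longleftrightarrow> mu_square \<mu> (inv w) \<pi>"
proof -
  obtain a where a: "set a \<subseteq> {1..<sum_list \<mu>}" "foldl hecke_right id a = w"
    using ex_reduced_word[OF w] by blast
  have "mu_act \<mu> id w = foldl (mu_act_gen \<mu>) id a"
    unfolding mu_act_def a(2)[symmetric]
  proof (rule extend_action_eq[OF _ a(1)])
    fix b assume b: "set b \<subseteq> {1..<sum_list \<mu>}" "foldl hecke_right id b = foldl hecke_right id a"
    show "foldl (mu_act_gen \<mu>) id b = foldl (mu_act_gen \<mu>) id a"
      by (rule mu_square_unique[OF mu_square_foldl[OF b(1)]])
        (unfold b(2), rule mu_square_foldl[OF a(1)])
  qed
  then have "mu_square \<mu> (inv w) (mu_act \<mu> id w)"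
    using mu_square_foldl[OF a(1)] unfolding a(2) by simp
  then show ?thesis using mu_square_unique by blast
qed

section \<open>Minimal length and atoms\<close>

text \<open>For fixed \<open>\<pi>\<close> only the sum over the blocks varies with
  \<open>v\<close>, so minimizing the length is a separate problem in each block.\<close>

lemma coxeter_length_mu_square:
  assumes "mu_square \<mu> v \<pi>"
  shows "coxeter_length v = cross_inversions (map set (blocks \<mu> \<pi>)) +
    (\<Sum>r<length \<mu>. coxeter_length (std (block \<mu> v r)))"
proof -
  have "map set (blocks \<mu> v) = map set (blocks \<mu> \<pi>)"
    using mu_squareD(3)[OF assms] by (intro nth_equalityI) (simp_all add: nth_blocks)
  then show ?thesis using coxeter_length_blocks[OF mu_squareD(1)[OF assms]] by simp
qed

lemma inv_length_le_block:
  assumes sq: "mu_square \<mu> v \<pi>" and r: "r < length \<mu>"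
  shows "inv_length (\<mu> ! r) (std (block \<mu> \<pi> r)) \<le> of_nat (coxeter_length (std (block \<mu> v r)))"
  unfolding mu_squareD(4)[OF sq r]
  by (rule inv_length_le(2)[OF std_block_permutes[OF mu_squareD(1)[OF sq]]])

text \<open>For each block \<open>ex_atom\<close> provides an inverse atom of the standardization
  and \<open>ex_std\<close> writes it in the letters of the block; the words obtained are
  concatenated.\<close>

lemma ex_minimal_mu_square:
  assumes "\<pi> \<in> mu_involutions \<mu>"
  shows "\<exists>v. mu_square \<mu> v \<pi> \<and> (\<forall>r<length \<mu>.
    of_nat (coxeter_length (std (block \<mu> v r))) = inv_length (\<mu> ! r) (std (block \<mu> \<pi> r)))"
proof -
  have \<pi>: "\<pi> permutes {1..sum_list \<mu>}" using assms by (simp add: mu_involutions_def)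
  have "\<exists>Q. set Q = set (block \<mu> \<pi> r) \<and> length Q = \<mu> ! r \<and>
      hecke_prod (\<mu> ! r) (std Q) (inv (std Q)) = std (block \<mu> \<pi> r) \<and>
      of_nat (coxeter_length (std Q)) = inv_length (\<mu> ! r) (std (block \<mu> \<pi> r))"
    if r: "r < length \<mu>" for r
  proof -
    let ?B = "block \<mu> \<pi> r"
    have "involution (\<mu> ! r) (std ?B)"
      using assms r by (simp add: mu_involutions_def set_blocks block_involution_def)
    then obtain u where u: "u permutes {1..\<mu> ! r}" "hecke_prod (\<mu> ! r) u (inv u) = std ?B"
      "of_nat (coxeter_length u) = inv_length (\<mu> ! r) (std ?B)"
      using ex_atom by blast
    have card: "card (set ?B) = \<mu> ! r" using distinct_card[OF distinct_block[OF \<pi>]] by simp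
    obtain Q where Q: "Q \<in> permutations_of_set (set ?B)" "std Q = u"
      using ex_std[of "set ?B" u] u(1) unfolding card by blast
    show ?thesis
      using permutations_of_setD(1)[OF Q(1)] length_finite_permutations_of_set[OF Q(1)] u(2,3)
      unfolding card Q(2)[symmetric] by blast
  qed
  then obtain Q where Q: "\<And>r. r < length \<mu> \<Longrightarrow> set (Q r) = set (block \<mu> \<pi> r) \<and> length (Q r) = \<mu> ! r \<and>
      hecke_prod (\<mu> ! r) (std (Q r)) (inv (std (Q r))) = std (block \<mu> \<pi> r) \<and>
      of_nat (coxeter_length (std (Q r))) = inv_length (\<mu> ! r) (std (block \<mu> \<pi> r))"
    by metis
  let ?Qs = "map Q [0..<length \<mu>]"
  let ?v = "perm_of_word (concat ?Qs)"
  have block: "block \<mu> ?v r = Q r" if "r < length \<mu>" for r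
    using block_perm_of_word[of ?Qs \<mu> r] Q that by simp
  have "?v permutes {1..sum_list \<mu>}"
    using Q by (intro perm_of_word_permutes concat_permutation[OF \<pi>]) simp_all
  then have "mu_square \<mu> ?v \<pi>"
    using Q by (intro mu_squareI[OF _ \<pi>]) (simp_all add: block)
  moreover have "\<forall>r<length \<mu>.
      of_nat (coxeter_length (std (block \<mu> ?v r))) = inv_length (\<mu> ! r) (std (block \<mu> \<pi> r))"
    using Q by (simp add: block)
  ultimately show ?thesis by blast
qed

text \<open>Compared in the rationals, where \<open>inv_length\<close> takes its values. The minimal
  \<open>v\<close> provides a word of this length. Any word is at least as long as its 0-Hecke
  product, whose inverse obeys the lower bound in each block.\<close>

lemma mu_length_eq:
  assumes "\<pi> \<in> mu_involutions \<mu>"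
  shows "of_nat (mu_length \<mu> \<pi>) = of_nat (cross_inversions (map set (blocks \<mu> \<pi>))) +
    (\<Sum>r<length \<mu>. inv_length (\<mu> ! r) (std (block \<mu> \<pi> r)))"
proof -
  obtain v where v: "mu_square \<mu> v \<pi>" "\<forall>r<length \<mu>.
      of_nat (coxeter_length (std (block \<mu> v r))) = inv_length (\<mu> ! r) (std (block \<mu> \<pi> r))"
    using ex_minimal_mu_square[OF assms] by blast
  note vp = mu_squareD(1)[OF v(1)]
  have v_len: "of_nat (coxeter_length v) = of_nat (cross_inversions (map set (blocks \<mu> \<pi>))) +
    (\<Sum>r<length \<mu>. inv_length (\<mu> ! r) (std (block \<mu> \<pi> r)))"
    unfolding coxeter_length_mu_square[OF v(1)] using v(2) by simp
  have "mu_length \<mu> \<pi> = coxeter_length v"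
    unfolding mu_length_def
  proof (rule Least_equality)
    \<comment> \<open>A reduced word for \<open>inv v\<close> serves as the shortest word leading to
      \<open>\<pi>\<close>.\<close>
    obtain a where a: "set a \<subseteq> {1..<sum_list \<mu>}" "foldl hecke_right id a = inv v"
      "length a = coxeter_length (inv v)"
      using ex_reduced_word[OF permutes_inv[OF vp]] by blast
    have "mu_square \<mu> v (foldl (mu_act_gen \<mu>) id a)"
      using mu_square_foldl[OF a(1)] unfolding a(2) permutes_inv_inv[OF vp] .
    then have "\<pi> = foldl (mu_act_gen \<mu>) id a" by (rule mu_square_unique[OF v(1)])
    then show "\<exists>a. mu_word \<mu> \<pi> a \<and> length a = coxeter_length v"
      unfolding mu_word_def using a(1,3) coxeter_length_inv[OF vp] by metis
  next
    fix p assume "\<exists>a. mu_word \<mu> \<pi> a \<and> length a = p"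
    then obtain a where a: "set a \<subseteq> {1..<sum_list \<mu>}" "\<pi> = foldl (mu_act_gen \<mu>) id a" "length a = p"
      unfolding mu_word_def by blast
    define w where "w = foldl hecke_right id a"
    have w: "w permutes {1..sum_list \<mu>}"
      unfolding w_def by (rule foldl_hecke_permutes(1)[OF permutes_id a(1)])
    have sq: "mu_square \<mu> (inv w) \<pi>"
      using mu_square_foldl[OF a(1)] unfolding w_def a(2)[symmetric] .
    have "(of_nat (coxeter_length v) :: rat) \<le> of_nat (coxeter_length (inv w))"
      unfolding v_len coxeter_length_mu_square[OF sq] of_nat_add of_nat_sum
      by (intro add_left_mono sum_mono inv_length_le_block[OF sq]) simp
    then have "coxeter_length v \<le> coxeter_length w"
      unfolding coxeter_length_inv[OF w] by simp
    also have "\<dots> \<le> p"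
      using coxeter_length_foldl_le[OF a(1)] unfolding w_def a(3) .
    finally show "coxeter_length v \<le> p" .
  qed
  with v_len show ?thesis by simp
qed

text \<open>The length is minimal when the sum of the block lengths equals the sum of their lower
  bounds. As the bound holds for each term, equality of the sums forces equality in every
  block.\<close>

lemma mem_inverse_mu_atoms_iff:
  assumes "\<pi> \<in> mu_involutions \<mu>"
  shows "v \<in> inverse_mu_atoms \<mu> \<pi> \<longleftrightarrow> mu_square \<mu> v \<pi> \<and> (\<forall>r<length \<mu>.
    of_nat (coxeter_length (std (block \<mu> v r))) = inv_length (\<mu> ! r) (std (block \<mu> \<pi> r)))"
proof -
  have "v \<in> inverse_mu_atoms \<mu> \<pi> \<longleftrightarrow> mu_square \<mu> v \<pi> \<and> coxeter_length v = mu_length \<mu> \<pi>"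
  proof
    assume "v \<in> inverse_mu_atoms \<mu> \<pi>"
    then obtain w where w: "v = inv w" "w permutes {1..sum_list \<mu>}" "mu_act \<mu> id w = \<pi>"
      "coxeter_length w = mu_length \<mu> \<pi>"
      unfolding inverse_mu_atoms_def mu_atoms_def by blast
    then show "mu_square \<mu> v \<pi> \<and> coxeter_length v = mu_length \<mu> \<pi>"
      using mu_act_eq_iff[OF w(2)] coxeter_length_inv[OF w(2)] by simp
  next
    assume v: "mu_square \<mu> v \<pi> \<and> coxeter_length v = mu_length \<mu> \<pi>"
    then have vp: "v permutes {1..sum_list \<mu>}" using mu_squareD(1) by blast
    have "inv v \<in> mu_atoms \<mu> \<pi>"
      unfolding mu_atoms_def mem_Collect_eq mu_act_eq_iff[OF permutes_inv[OF vp]]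
        permutes_inv_inv[OF vp] coxeter_length_inv[OF vp]
      using v permutes_inv[OF vp] by blast
    then have "inv (inv v) \<in> inverse_mu_atoms \<mu> \<pi>"
      unfolding inverse_mu_atoms_def by (rule imageI)
    then show "v \<in> inverse_mu_atoms \<mu> \<pi>" unfolding permutes_inv_inv[OF vp] .
  qed
  moreover have "coxeter_length v = mu_length \<mu> \<pi> \<longleftrightarrow> (\<forall>r<length \<mu>.
      of_nat (coxeter_length (std (block \<mu> v r))) = inv_length (\<mu> ! r) (std (block \<mu> \<pi> r)))"
    if sq: "mu_square \<mu> v \<pi>"
  proof -
    let ?f = "\<lambda>r. inv_length (\<mu> ! r) (std (block \<mu> \<pi> r))"
    let ?g = "\<lambda>r. of_nat (coxeter_length (std (block \<mu> v r))) :: rat"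
    have "coxeter_length v = mu_length \<mu> \<pi> \<longleftrightarrow>
        (of_nat (coxeter_length v) :: rat) = of_nat (mu_length \<mu> \<pi>)"
      by simp
    also have "\<dots> \<longleftrightarrow> sum ?g {..<length \<mu>} = sum ?f {..<length \<mu>}"
      unfolding mu_length_eq[OF assms] coxeter_length_mu_square[OF sq] of_nat_add of_nat_sum
      by (rule add_left_cancel)
    also have "\<dots> \<longleftrightarrow> (\<forall>r<length \<mu>. ?g r = ?f r)"
    proof
      assume eq: "sum ?g {..<length \<mu>} = sum ?f {..<length \<mu>}"
      show "\<forall>r<length \<mu>. ?g r = ?f r"
      proof (intro allI impI)
        fix r assume "r < length \<mu>"
        then have "?f r = ?g r"
          using inv_length_le_block[OF sq] by (intro sum_mono_inv[OF eq[symmetric]]) simp_all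
        then show "?g r = ?f r" ..
      qed
    qed simp
    finally show ?thesis .
  qed
  ultimately show ?thesis by blast
qed

text \<open>An inverse atom is \<open>inv w\<close> for an atom \<open>w\<close>, so the condition
  on \<open>hecke_prod m (inv w) w\<close> becomes one on \<open>std Q\<close> and its inverse, the
  form used in \<open>mu_square\<close>.\<close>

lemma mem_inverse_block_atoms_iff:
  assumes "distinct B"
  shows "Q \<in> inverse_block_atoms B \<longleftrightarrow> set Q = set B \<and> distinct Q \<and>
    hecke_prod (length B) (std Q) (inv (std Q)) = std B \<and>
    of_nat (coxeter_length (std Q)) = inv_length (length B) (std B)"
proof (cases "set Q = set B \<and> distinct Q")
  case True
  then have "length Q = length B" using assms distinct_card by metis
  then have p: "std Q permutes {1..length B}" using std_permutes True by metis
  have "std Q \<in> inverse_atoms (length B) (std B) \<longleftrightarrow> inv (std Q) \<in> atoms (length B) (std B)"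
  proof
    assume "std Q \<in> inverse_atoms (length B) (std B)"
    then obtain w where w: "std Q = inv w" "w \<in> atoms (length B) (std B)"
      unfolding inverse_atoms_def by blast
    then have "w permutes {1..length B}" by (simp add: atoms_def)
    then show "inv (std Q) \<in> atoms (length B) (std B)"
      using w by (simp add: permutes_inv_inv)
  next
    assume "inv (std Q) \<in> atoms (length B) (std B)"
    then have "inv (inv (std Q)) \<in> inverse_atoms (length B) (std B)"
      unfolding inverse_atoms_def by (rule imageI)
    then show "std Q \<in> inverse_atoms (length B) (std B)" unfolding permutes_inv_inv[OF p] .
  qed
  then show ?thesis
    using True p permutes_inv[OF p]
    by (auto simp: inverse_block_atoms_def atoms_def permutes_inv_inv[OF p] coxeter_length_inv[OF p]
        permutations_of_set_def)
next
  case False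
  then show ?thesis by (auto simp: inverse_block_atoms_def permutations_of_set_def)
qed

theorem theorem3p1:
  fixes n :: nat and \<mu> :: "nat list" and \<pi> :: "nat \<Rightarrow> nat"
  assumes "composition \<mu> n"
    and "\<pi> \<in> mu_involutions \<mu>"
  shows "one_line n ` inverse_mu_atoms \<mu> \<pi> =
    {concat Qs | Qs. length Qs = length \<mu> \<and>
       (\<forall>i < length \<mu>. Qs ! i \<in> inverse_block_atoms (block \<mu> \<pi> i))}"
proof -
  have n: "n = sum_list \<mu>" using assms(1) by (simp add: composition_def)
  have \<pi>: "\<pi> permutes {1..sum_list \<mu>}" using assms(2) by (simp add: mu_involutions_def)
  note block_atoms = mem_inverse_block_atoms_iff[OF distinct_block[OF \<pi>], of _ \<mu>, unfolded length_block]
  \<comment> \<open>\<open>mu_square\<close> together with the equality of lengths is, block by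
    block, the criterion for inverse block atoms.\<close>
  have atoms: "v \<in> inverse_mu_atoms \<mu> \<pi> \<longleftrightarrow>
      (\<forall>r<length \<mu>. block \<mu> v r \<in> inverse_block_atoms (block \<mu> \<pi> r))"
    if v: "v permutes {1..sum_list \<mu>}" for v
    unfolding mem_inverse_mu_atoms_iff[OF assms(2)] block_atoms mu_square_def
    using v \<pi> distinct_block[OF v] by auto
  show ?thesis
  proof (intro equalityI subsetI)
    fix x assume "x \<in> one_line n ` inverse_mu_atoms \<mu> \<pi>"
    then obtain v where v: "x = one_line n v" "v \<in> inverse_mu_atoms \<mu> \<pi>" by blast
    then have vp: "v permutes {1..sum_list \<mu>}"
      using mem_inverse_mu_atoms_iff[OF assms(2)] mu_squareD(1) by blast
    have "x = concat (blocks \<mu> v)" unfolding v(1) n concat_blocks ..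
    moreover have "\<forall>i<length \<mu>. blocks \<mu> v ! i \<in> inverse_block_atoms (block \<mu> \<pi> i)"
      using v(2) unfolding atoms[OF vp] by (simp add: nth_blocks)
    ultimately show "x \<in> {concat Qs | Qs. length Qs = length \<mu> \<and>
       (\<forall>i < length \<mu>. Qs ! i \<in> inverse_block_atoms (block \<mu> \<pi> i))}"
      using length_blocks[of \<mu> v] by blast
  next
    fix x assume "x \<in> {concat Qs | Qs. length Qs = length \<mu> \<and>
       (\<forall>i < length \<mu>. Qs ! i \<in> inverse_block_atoms (block \<mu> \<pi> i))}"
    then obtain Qs where x: "x = concat Qs" and len: "length Qs = length \<mu>"
      and Qs: "\<And>i. i < length \<mu> \<Longrightarrow> Qs ! i \<in> inverse_block_atoms (block \<mu> \<pi> i)" by blast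
    have sets: "set (Qs ! r) = set (block \<mu> \<pi> r) \<and> length (Qs ! r) = \<mu> ! r" if "r < length \<mu>" for r
    proof -
      have "set (Qs ! r) = set (block \<mu> \<pi> r)" "distinct (Qs ! r)"
        using Qs[OF that] unfolding block_atoms by blast+
      then show ?thesis
        using distinct_card[of "Qs ! r"] distinct_card[OF distinct_block[OF \<pi>, of \<mu> r]] by simp
    qed
    have perm: "concat Qs \<in> permutations_of_set {1..sum_list \<mu>}"
      by (rule concat_permutation[OF \<pi> len sets])
    \<comment> \<open>The lengths of the words match \<open>\<mu>\<close>, so cutting the
      concatenation into blocks returns \<open>Qs\<close>.\<close>
    have block: "block \<mu> (perm_of_word (concat Qs)) r = Qs ! r" if "r < length \<mu>" for r
      using block_perm_of_word[OF len _ that] sets by blast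
    have "perm_of_word (concat Qs) \<in> inverse_mu_atoms \<mu> \<pi>"
      unfolding atoms[OF perm_of_word_permutes[OF perm]] using block Qs by simp
    moreover have "one_line n (perm_of_word (concat Qs)) = x"
      using length_finite_permutations_of_set[OF perm] unfolding x n
      by (intro one_line_perm_of_word) simp
    ultimately show "x \<in> one_line n ` inverse_mu_atoms \<mu> \<pi>" by blast
  qed
qed

end
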